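(* Let $m\in\mathbb N$ and $\varphi\in\mathscr K(\mathbb R^m)$, and let $\psi(x)=e^{-|x|^2/4}\varphi(x)$. Then for every $t\in(0,\pi)$ the function $f(x,t)=e^{it\mathscr L}\varphi(x)$ is given by the formula $$e^{-\frac{|x|^2}{4}} f(x,t) = (4\pi)^{-\frac m2}\,\frac{e^{\frac{imt}{2}}}{e^{\frac{i\pi m}{4}}(\sin t)^{\frac m2}}\; e^{i\frac{\cot t\,|x|^2}{4}}\;\mathscr F\!\left(e^{i\frac{\cot t\,|\cdot|^2}{4}}\psi\right)\!\left(\frac{x}{4\pi\sin t}\right).$$
   Context: Functions are complex-valued. $\mathscr L f=\Delta f-\langle x,\nabla f\rangle$ is the Ornstein-Uhlenbeck operator on $\mathbb R^m$ and $d\gamma(x)=(2\pi)^{-m/2}e^{-|x|^2/2}dx$ is its invariant measure. $\mathscr L$ is self-adjoint in $L^2(\mathbb R^m,d\gamma)$, and $e^{it\mathscr L}$, $t\in\mathbb R$, is the associated strongly continuous group of unitary operators on $L^2(\mathbb R^m,d\gamma)$ (Stone's theorem), so that $f(\cdot,t)=e^{it\mathscr L}\varphi$ solves $\partial_t f-i\mathscr L f=0$, $f(\cdot,0)=\varphi$; elements of $L^2$ are functions up to a.e. equality. $\mathscr S(\mathbb R^m)$ is the Schwartz space and $\mathscr K(\mathbb R^m)=\{\varphi\in C^\infty(\mathbb R^m): e^{-|\cdot|^2/4}\varphi\in\mathscr S(\mathbb R^m)\}$. The Fourier transform is $\mathscr F(u)(\xi)=\int_{\mathbb R^m}e^{-2\pi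 i\langle\xi,x\rangle}u(x)\,dx$. *)

theory Defs
  imports "HOL-Analysis.Analysis"
begin

section \<open>Smooth functions and function spaces\<close>

text \<open>Iterated partial derivatives along a list of directions; in all uses below the
  directions are vectors of the standard basis, so a list plays the role of a multi-index.\<close>

fun partials :: "'a::euclidean_space list \<Rightarrow> ('a \<Rightarrow> complex) \<Rightarrow> 'a \<Rightarrow> complex" where
  "partials [] f = f"
| "partials (b # bs) f = (\<lambda>x. frechet_derivative (partials bs f) (at x) b)"

text \<open>\<open>frechet_derivative\<close> is an unspecified value where the function is not differentiable. Here
  differentiability is required at every order, so all the partial derivatives involved exist
  and are continuous.\<close>

definition smooth :: "('a::euclidean_space \<Rightarrow> complex) \<Rightarrow> bool" where
  "smooth f \<longleftrightarrow> (\<forall>bs \<in> lists Basis. \<forall>x. partials bs f differentiable (at x))"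

definition test_function :: "('a::euclidean_space \<Rightarrow> complex) \<Rightarrow> bool" where
  "test_function \<eta> \<longleftrightarrow> smooth \<eta> \<and> compact (closure {x. \<eta> x \<noteq> 0})"

definition schwartz :: "('a::euclidean_space \<Rightarrow> complex) set" where
  "schwartz = {f. smooth f \<and>
     (\<forall>k. \<forall>bs \<in> lists Basis. \<exists>C. \<forall>x. norm x ^ k * cmod (partials bs f x) \<le> C)}"

definition K_space :: "('a::euclidean_space \<Rightarrow> complex) set" where
  "K_space = {\<phi>. smooth \<phi> \<and> (\<lambda>x. complex_of_real (exp (- (norm x)\<^sup>2 / 4)) * \<phi> x) \<in> schwartz}"

definition fourier :: "('a::euclidean_space \<Rightarrow> complex) \<Rightarrow> 'a \<Rightarrow> complex" where
  "fourier u \<xi> = (LINT x|lborel. exp (- 2 * complex_of_real pi * \<i> * complex_of_real (\<xi> \<bullet> x)) * u x)"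

section \<open>Operators and unitary groups on complex \<open>L\<^sup>2\<close>\<close>

text \<open>Elements of \<open>L\<^sup>2(M)\<close> are represented by functions. Operators act on representatives, and
  identities between elements of \<open>L\<^sup>2(M)\<close> are required almost everywhere.\<close>

definition L2 :: "'a measure \<Rightarrow> ('a \<Rightarrow> complex) set" where
  "L2 M = {f \<in> borel_measurable M. integrable M (\<lambda>x. (cmod (f x))\<^sup>2)}"

definition l2_inner :: "'a measure \<Rightarrow> ('a \<Rightarrow> complex) \<Rightarrow> ('a \<Rightarrow> complex) \<Rightarrow> complex" where
  "l2_inner M f g = (LINT x|M. f x * cnj (g x))"

definition l2_norm :: "'a measure \<Rightarrow> ('a \<Rightarrow> complex) \<Rightarrow> real" where
  "l2_norm M f = sqrt (LINT x|M. (cmod (f x))\<^sup>2)"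

text \<open>Surjectivity of each \<open>U t\<close>, hence unitarity, follows from the group law. Preservation of
  the inner product and linearity together make \<open>U t\<close> respect equality almost everywhere.\<close>

definition unitary_group ::
    "'a measure \<Rightarrow> (real \<Rightarrow> ('a \<Rightarrow> complex) \<Rightarrow> ('a \<Rightarrow> complex)) \<Rightarrow> bool" where
  "unitary_group M U \<longleftrightarrow>
     (\<forall>t. \<forall>f\<in>L2 M. U t f \<in> L2 M) \<and>
     (\<forall>t. \<forall>f\<in>L2 M. \<forall>g\<in>L2 M. \<forall>a b.
        AE x in M. U t (\<lambda>y. a * f y + b * g y) x = a * U t f x + b * U t g x) \<and>
     (\<forall>t. \<forall>f\<in>L2 M. \<forall>g\<in>L2 M. l2_inner M (U t f) (U t g) = l2_inner M f g) \<and>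
     (\<forall>f\<in>L2 M. AE x in M. U 0 f x = f x) \<and>
     (\<forall>s t. \<forall>f\<in>L2 M. AE x in M. U (s + t) f x = U s (U t f) x) \<and>
     (\<forall>f\<in>L2 M. \<forall>s. ((\<lambda>t. l2_norm M (\<lambda>x. U t f x - U s f x)) \<longlongrightarrow> 0) (at s))"

text \<open>Possibly unbounded operators are given by their graphs: \<open>A f g\<close> says that \<open>f\<close> is in the
  domain and is mapped to \<open>g\<close>.\<close>

definition generator ::
    "'a measure \<Rightarrow> (real \<Rightarrow> ('a \<Rightarrow> complex) \<Rightarrow> ('a \<Rightarrow> complex)) \<Rightarrow>
     ('a \<Rightarrow> complex) \<Rightarrow> ('a \<Rightarrow> complex) \<Rightarrow> bool" where
  "generator M U f g \<longleftrightarrow> f \<in> L2 M \<and> g \<in> L2 M \<and>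
     ((\<lambda>h. l2_norm M (\<lambda>x. (U h f x - f x) / complex_of_real h - g x)) \<longlongrightarrow> 0) (at 0)"

text \<open>\<open>U t = e\<^sup>i\<^sup>t\<^sup>A\<close>: the strongly continuous unitary group whose generator is exactly \<open>\<i> A\<close>.
  For self-adjoint \<open>A\<close>, Stone's theorem gives such a group, unique up to equality almost
  everywhere.\<close>

definition is_exp_itA ::
    "'a measure \<Rightarrow> (('a \<Rightarrow> complex) \<Rightarrow> ('a \<Rightarrow> complex) \<Rightarrow> bool) \<Rightarrow>
     (real \<Rightarrow> ('a \<Rightarrow> complex) \<Rightarrow> ('a \<Rightarrow> complex)) \<Rightarrow> bool" where
  "is_exp_itA M A U \<longleftrightarrow> unitary_group M U \<and>
     (\<forall>f\<in>L2 M. \<forall>g\<in>L2 M. generator M U f (\<lambda>x. \<i> * g x) \<longleftrightarrow> A f g)"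

section \<open>The Ornstein-Uhlenbeck operator\<close>

definition gauss_measure :: "'a::euclidean_space measure" where
  "gauss_measure = density lborel
     (\<lambda>x. ennreal ((2 * pi) powr (- real DIM('a) / 2) * exp (- (norm x)\<^sup>2 / 2)))"

definition OU_expr :: "('a::euclidean_space \<Rightarrow> complex) \<Rightarrow> 'a \<Rightarrow> complex" where
  "OU_expr f x = (\<Sum>b\<in>Basis. partials [b, b] f x)
     - (\<Sum>b\<in>Basis. complex_of_real (x \<bullet> b) * partials [b] f x)"

text \<open>The self-adjoint realization in \<open>L\<^sup>2(\<gamma>)\<close>, with domain the \<open>f \<in> L\<^sup>2(\<gamma>)\<close> for which the
  Ornstein-Uhlenbeck expression, taken in the sense of distributions, is again in \<open>L\<^sup>2(\<gamma>)\<close>.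
  As \<open>OU_expr\<close> is symmetric and essentially self-adjoint on the test functions, its adjoint
  written here is its closure, and its only self-adjoint extension.\<close>

definition OU_operator ::
    "('a::euclidean_space \<Rightarrow> complex) \<Rightarrow> ('a \<Rightarrow> complex) \<Rightarrow> bool" where
  "OU_operator f g \<longleftrightarrow> f \<in> L2 gauss_measure \<and> g \<in> L2 gauss_measure \<and>
     (\<forall>\<eta>. test_function \<eta> \<longrightarrow> l2_inner gauss_measure g \<eta> = l2_inner gauss_measure f (OU_expr \<eta>))"

end

theory Submission
  imports Defs "HOL-Probability.Probability"
begin

text \<open>The generating functions \<open>H\<^sub>c(x) = exp (c \<xi>\<cdot>x - c\<^sup>2|\<xi>|\<^sup>2/2)\<close> of the Hermite polynomials are
  moved explicitly by the group: \<open>e\<^sup>i\<^sup>t\<^sup>L\<close> multiplies the parameter \<open>c\<close> by \<open>e\<^sup>-\<^sup>i\<^sup>t\<close>, because the resulting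
  curve is differentiable in \<open>L\<^sup>2(\<gamma>)\<close> and solves the Schroedinger equation. Unitarity therefore gives
  the inner product of \<open>e\<^sup>i\<^sup>t\<^sup>L \<phi>\<close> with every \<open>H\<^sub>\<i>\<close>, that is, the Fourier transform of \<open>e\<^sup>i\<^sup>t\<^sup>L \<phi>\<close> times
  the Gaussian density. Fubini's theorem and a complex Gaussian integral give the same value for
  the right-hand side of the formula, and the Fourier transform is injective on \<open>L\<^sup>1\<close>.\<close>

section \<open>Integrals over Euclidean space\<close>

text \<open>On \<open>hermite_exp\<close> the operator acts as -c d/dc: the coefficient of c^n in
  its expansion is a multiple of a Hermite polynomial of degree n, an eigenfunction for -n. Hence
  the rotation of c by e^(-it). Checking directly that the right-hand side of the formula solves the
  equation would require differentiability in L2(\<gamma>) and the limit at t = 0, where the kernel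
  is singular. Duality avoids both: the group is computed on explicit functions, and t stays fixed
  when the formula enters. The parameter i is chosen because the conjugate of
  \<open>hermite_exp \<xi> \<i>\<close>, times e^(-|\<xi>|^2/2), is the character e^(-i \<xi>.x).
  The Gaussian density splits into two factors e^(-|x|^2/4): one is the factor in front of f in the
  formula, the other makes the double integral converge absolutely although the kernel of the
  formula is purely oscillatory. After Fubini the inner integral is Gaussian with parameter (1 - i
  cot t)/4, of positive real part, and its principal square root settles the branch hidden in e^(i
  pi m/4) (sin t)^(m/2).\<close>

lemma has_vector_derivative_iff_quotient:
  "(f has_vector_derivative D) (at a) \<longleftrightarrow> ((\<lambda>h. (f (a + h) - f a) /\<^sub>R h) \<longlongrightarrow> D) (at 0)"
proof -
  have eq: "norm (f (a + h) - f a - h *\<^sub>R D) / norm h = norm ((f (a + h) - f a) /\<^sub>R h - D)"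
    if "h \<noteq> 0" for h
  proof -
    have "(f (a + h) - f a) /\<^sub>R h - D = (f (a + h) - f a - h *\<^sub>R D) /\<^sub>R h"
      using that by (simp add: algebra_simps)
    then show ?thesis by (simp add: divide_inverse mult.commute)
  qed
  have "(f has_vector_derivative D) (at a) \<longleftrightarrow>
      ((\<lambda>h. norm (f (a + h) - f a - h *\<^sub>R D) / norm h) \<longlongrightarrow> 0) (at 0)"
    unfolding has_vector_derivative_def has_derivative_at
    by (simp add: bounded_linear_scaleR_left)
  also have "\<dots> \<longleftrightarrow> ((\<lambda>h. norm ((f (a + h) - f a) /\<^sub>R h - D)) \<longlongrightarrow> 0) (at 0)"
    by (rule filterlim_cong[OF refl refl]) (use eq in \<open>auto simp: eventually_at_filter\<close>)
  also have "\<dots> \<longleftrightarrow> ((\<lambda>h. (f (a + h) - f a) /\<^sub>R h) \<longlongrightarrow> D) (at 0)"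
    by (simp add: tendsto_norm_zero_iff flip: LIM_zero_iff[of _ D])
  finally show ?thesis .
qed

lemma norm_increment_le:
  fixes f :: "real \<Rightarrow> 'b::real_normed_vector"
  assumes "\<And>s. \<bar>s - a\<bar> < r \<Longrightarrow> (f has_vector_derivative f' s) (at s)"
    and "\<And>s. \<bar>s - a\<bar> < r \<Longrightarrow> norm (f' s) \<le> B" and "\<bar>h\<bar> < r"
  shows "norm (f (a + h) - f a) \<le> B * \<bar>h\<bar>"
proof -
  have "norm (f (a + h) - f a) \<le> B * norm (a + h - a)"
  proof (rule differentiable_bound[where S = "ball a r" and f' = "\<lambda>s x. x *\<^sub>R f' s"])
    fix s assume "s \<in> ball a r"
    then have s: "\<bar>s - a\<bar> < r" by (simp add: dist_real_def abs_minus_commute)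
    show "(f has_derivative (\<lambda>x. x *\<^sub>R f' s)) (at s within ball a r)"
      using assms(1)[OF s] unfolding has_vector_derivative_def by (rule has_derivative_at_withinI)
    show "onorm (\<lambda>x. x *\<^sub>R f' s) \<le> B"
      using assms(2)[OF s] by (intro onorm_le) (simp add: mult.commute[of B] mult_left_mono)
  qed (use assms(3) in \<open>auto simp: dist_real_def\<close>)
  then show ?thesis by simp
qed

text \<open>A limit along \<open>at a\<close> is tested on sequences. The majorant holds only near
  a, so each sequence is shifted by N before the sequential theorem applies.\<close>

lemma integral_dominated_convergence_at:
  fixes s :: "'b::first_countable_topology \<Rightarrow> 'a \<Rightarrow> 'c::{banach, second_countable_topology}"
  assumes f: "f \<in> borel_measurable M"
    and ev: "eventually (\<lambda>h. s h \<in> borel_measurable M \<and> (\<forall>x. norm (s h x) \<le> w x)) (at a)"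
    and lim: "\<And>x. ((\<lambda>h. s h x) \<longlongrightarrow> f x) (at a)"
    and w: "integrable M w"
  shows "((\<lambda>h. integral\<^sup>L M (s h)) \<longlongrightarrow> integral\<^sup>L M f) (at a)"
  unfolding tendsto_at_iff_sequentially comp_def
proof (intro allI impI)
  fix X assume X: "\<forall>i::nat. X i \<in> UNIV - {a}" and Xa: "X \<longlonglongrightarrow> a"
  have Xat: "filterlim X (at a) sequentially"
    using X Xa by (auto simp: filterlim_at)
  obtain N where N: "\<And>n. n \<ge> N \<Longrightarrow> s (X n) \<in> borel_measurable M \<and> (\<forall>x. norm (s (X n) x) \<le> w x)"
    using filterlim_iff[THEN iffD1, OF Xat, rule_format, OF ev]
    by (auto simp: eventually_sequentially)
  show "(\<lambda>i. integral\<^sup>L M (s (X i))) \<longlonglongrightarrow> integral\<^sup>L M f"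
  proof (rule LIMSEQ_offset[where k = N], rule integral_dominated_convergence[OF f _ w])
    show "AE x in M. (\<lambda>i. s (X (i + N)) x) \<longlonglongrightarrow> f x"
      using LIMSEQ_ignore_initial_segment[OF filterlim_compose[OF lim Xat]] by auto
  qed (use N in auto)
qed

text \<open>By the mean value inequality the function g that bounds the derivative also bounds the
  difference quotients, which is the majorant that dominated convergence needs.\<close>

lemma has_vector_derivative_integral:
  fixes f :: "real \<Rightarrow> 'a \<Rightarrow> complex"
  assumes r: "0 < r"
    and int: "\<And>s. \<bar>s - a\<bar> < r \<Longrightarrow> integrable M (f s)"
    and der: "\<And>s x. \<bar>s - a\<bar> < r \<Longrightarrow> ((\<lambda>s. f s x) has_vector_derivative f' s x) (at s)"
    and bound: "\<And>s x. \<bar>s - a\<bar> < r \<Longrightarrow> norm (f' s x) \<le> g x"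
    and meas: "f' a \<in> borel_measurable M" and g: "integrable M g"
  shows "((\<lambda>s. LINT x|M. f s x) has_vector_derivative (LINT x|M. f' a x)) (at a)"
proof -
  have ev: "eventually (\<lambda>h. \<bar>h\<bar> < r \<and> h \<noteq> 0) (at (0::real))"
    using r unfolding eventually_at by (intro exI[of _ r]) (auto simp: dist_real_def)
  have 1: "((\<lambda>h. LINT x|M. (f (a + h) x - f a x) /\<^sub>R h) \<longlongrightarrow> (LINT x|M. f' a x)) (at 0)"
  proof (rule integral_dominated_convergence_at[OF meas _ _ g])
    show "((\<lambda>h. (f (a + h) x - f a x) /\<^sub>R h) \<longlongrightarrow> f' a x) (at 0)" for x
      using der[of a x] r by (simp add: has_vector_derivative_iff_quotient)
    show "\<forall>\<^sub>F h in at 0. (\<lambda>x. (f (a + h) x - f a x) /\<^sub>R h) \<in> borel_measurable M \<and>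
        (\<forall>x. norm ((f (a + h) x - f a x) /\<^sub>R h) \<le> g x)"
      using ev
    proof eventually_elim
      case (elim h)
      have [measurable]: "f (a + h) \<in> borel_measurable M" "f a \<in> borel_measurable M"
        using int[of "a + h"] int[of a] elim r by auto
      have "norm ((f (a + h) x - f a x) /\<^sub>R h) \<le> g x" for x
      proof -
        have "norm (f (a + h) x - f a x) \<le> g x * \<bar>h\<bar>"
          using elim norm_increment_le[of a r "\<lambda>s. f s x" "\<lambda>s. f' s x" "g x" h, OF der bound]
          by auto
        then show ?thesis using elim by (simp add: divide_inverse_commute[symmetric] pos_divide_le_eq)
      qed
      moreover have "(\<lambda>x. (f (a + h) x - f a x) /\<^sub>R h) \<in> borel_measurable M" by measurable
      ultimately show ?case by blast
    qed
  qed
  have 2: "\<forall>\<^sub>F h in at 0. (LINT x|M. (f (a + h) x - f a x) /\<^sub>R h) =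
      ((LINT x|M. f (a + h) x) - (LINT x|M. f a x)) /\<^sub>R h"
    using ev
  proof eventually_elim
    case (elim h)
    then have "integrable M (f (a + h))" "integrable M (f a)"
      using int[of "a + h"] int[of a] r by auto
    then show ?case by simp
  qed
  show ?thesis
    unfolding has_vector_derivative_iff_quotient
    using 1 tendsto_cong[OF 2] by blast
qed

section \<open>Translation invariance, product integrands and real Gaussians\<close>

lemma integrable_translate:
  fixes f :: "'a::euclidean_space \<Rightarrow> 'b::{banach, second_countable_topology}"
  assumes "integrable lborel f"
  shows "integrable lborel (\<lambda>x. f (x + c))"
proof -
  have "integrable (distr lborel borel ((+) c)) f"
    using assms by (simp add: lborel_distr_plus)
  then show ?thesis
    by (subst (asm) integrable_distr_eq) (use assms in \<open>auto simp: add.commute\<close>)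
qed

lemma integral_translate:
  fixes f :: "'a::euclidean_space \<Rightarrow> 'b::{banach, second_countable_topology}"
  assumes "f \<in> borel_measurable borel"
  shows "(LINT x|lborel. f (x + c)) = (LINT x|lborel. f x)"
proof -
  have "(LINT x|lborel. f x) = (LINT x|distr lborel borel ((+) c). f x)"
    by (simp add: lborel_distr_plus)
  also have "\<dots> = (LINT x|lborel. f (x + c))"
    using assms by (subst integral_distr) (auto simp: add.commute)
  finally show ?thesis ..
qed

text \<open>The integral of \<open>F\<close> is invariant under translation, so its derivative along \<open>b\<close> vanishes.\<close>

lemma integral_directional_derivative_eq_0:
  fixes F F' :: "'a::euclidean_space \<Rightarrow> complex"
  assumes F: "integrable lborel F"
    and der: "\<And>x. ((\<lambda>s. F (x + s *\<^sub>R b)) has_vector_derivative F' x) (at 0)"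
    and bound: "\<And>x s. \<bar>s\<bar> < 1 \<Longrightarrow> norm (F' (x + s *\<^sub>R b)) \<le> g x"
    and g: "integrable lborel g" and meas: "F' \<in> borel_measurable borel"
  shows "(LINT x|lborel. F' x) = 0"
proof -
  have "((\<lambda>s. LINT x|lborel. F (x + s *\<^sub>R b)) has_vector_derivative
      (LINT x|lborel. F' (x + 0 *\<^sub>R b))) (at 0)"
  proof (rule has_vector_derivative_integral[where r = 1 and g = g])
    fix s :: real and x
    have "((\<lambda>h. F ((x + s *\<^sub>R b) + h *\<^sub>R b)) has_vector_derivative F' (x + s *\<^sub>R b)) (at 0)"
      by (rule der)
    then show "((\<lambda>s. F (x + s *\<^sub>R b)) has_vector_derivative F' (x + s *\<^sub>R b)) (at s)"
      unfolding has_vector_derivative_iff_quotient by (simp add: algebra_simps)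
  qed (use assms in \<open>auto intro: integrable_translate\<close>)
  moreover have "(LINT x|lborel. F (x + s *\<^sub>R b)) = (LINT x|lborel. F x)" for s
    using F by (intro integral_translate) auto
  ultimately have "((\<lambda>s. LINT x|lborel. F x) has_vector_derivative (LINT x|lborel. F' x)) (at (0::real))"
    by simp
  then show ?thesis
    using vector_derivative_unique_at has_vector_derivative_const by metis
qed

text \<open>Lebesgue measure is the image of the product of one-dimensional Lebesgue measures under
  the coordinate map \<open>?T\<close>, so product integrands factor.\<close>

lemma lborel_prod_Basis:
  fixes f :: "'a::euclidean_space \<Rightarrow> real \<Rightarrow> 'b::{real_normed_field, banach, second_countable_topology}"
  assumes f: "\<And>b. b \<in> Basis \<Longrightarrow> integrable lborel (f b)"
  shows integrable_lborel_prod_Basis: "integrable lborel (\<lambda>x. \<Prod>b\<in>Basis. f b (x \<bullet> b))"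
    and integral_lborel_prod_Basis:
      "(LINT x|lborel. (\<Prod>b\<in>Basis. f b (x \<bullet> b))) = (\<Prod>b\<in>Basis. integral\<^sup>L lborel (f b))"
proof -
  interpret product_sigma_finite "\<lambda>_::'a. lborel :: real measure" ..
  let ?P = "\<Pi>\<^sub>M b\<in>(Basis::'a set). (lborel :: real measure)"
  let ?T = "\<lambda>f. \<Sum>b\<in>(Basis::'a set). f b *\<^sub>R b"
  have [measurable]: "f b \<in> borel_measurable borel" if "b \<in> Basis" for b
    using borel_measurable_integrable[OF f[OF that]] by simp
  have T[measurable]: "?T \<in> ?P \<rightarrow>\<^sub>M borel" by measurable
  have m: "(\<lambda>x. \<Prod>b\<in>Basis. f b (x \<bullet> b)) \<in> borel_measurable borel" by measurable
  have eq: "(\<Prod>b\<in>Basis. f b (?T x \<bullet> b)) = (\<Prod>b\<in>Basis. f b (x b))" for x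
    by (intro prod.cong) (auto simp: inner_sum_left inner_Basis if_distrib sum.delta cong: if_cong)
  have "integrable ?P (\<lambda>x. \<Prod>b\<in>Basis. f b (x b))"
    by (rule product_integrable_prod) (use f in auto)
  then have "integrable (distr ?P borel ?T) (\<lambda>x. \<Prod>b\<in>Basis. f b (x \<bullet> b))"
    by (subst integrable_distr_eq[OF T m]) (simp add: eq)
  then show "integrable lborel (\<lambda>x. \<Prod>b\<in>Basis. f b (x \<bullet> b))"
    by (simp flip: lborel_eq)
  have "(LINT x|lborel. (\<Prod>b\<in>Basis. f b (x \<bullet> b))) = (LINT x|distr ?P borel ?T. (\<Prod>b\<in>Basis. f b (x \<bullet> b)))"
    by (simp flip: lborel_eq)
  also have "\<dots> = (LINT x|?P. (\<Prod>b\<in>Basis. f b (x b)))"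
    by (subst integral_distr[OF T m]) (simp add: eq)
  also have "\<dots> = (\<Prod>b\<in>Basis. integral\<^sup>L lborel (f b))"
    by (rule product_integral_prod) (use f in auto)
  finally show "(LINT x|lborel. (\<Prod>b\<in>Basis. f b (x \<bullet> b))) = (\<Prod>b\<in>Basis. integral\<^sup>L lborel (f b))" .
qed

text \<open>One quarter of the exponent \<delta> r^2 absorbs the linear term by completing the
  square, another quarter absorbs the polynomial factor, and half is left. Since C depends only on
  \<delta> and B, the bound is uniform over all Gaussians whose parameters obey these two
  bounds.\<close>

lemma gaussian_absorbs:
  fixes \<delta> B :: real
  assumes "0 < \<delta>"
  shows "\<exists>C. \<forall>r. (1 + r\<^sup>2) * exp (B * \<bar>r\<bar> - \<delta> * r\<^sup>2) \<le> C * exp (- (\<delta> / 2) * r\<^sup>2)"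
proof (intro exI allI)
  fix r :: real
  \<comment> \<open>The least m with 1 \<le> m and 1 \<le> m \<delta>/4, so that 1 + r^2 \<le> m (1
    + \<delta>/4 r^2).\<close>
  define m where "m = max 1 (4 / \<delta>)"
  have "B * \<bar>r\<bar> \<le> B\<^sup>2 / \<delta> + \<delta> / 4 * r\<^sup>2"
  proof -
    have "0 \<le> (B - \<delta> / 2 * \<bar>r\<bar>)\<^sup>2 / \<delta>" using assms by simp
    also have "\<dots> = B\<^sup>2 / \<delta> - B * \<bar>r\<bar> + \<delta> / 4 * r\<^sup>2"
      using assms by (simp add: power2_eq_square field_simps)
    finally show ?thesis by simp
  qed
  then have e: "exp (B * \<bar>r\<bar> - \<delta> * r\<^sup>2) \<le> exp (B\<^sup>2 / \<delta>) * exp (- (3 * \<delta> / 4) * r\<^sup>2)"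
    by (simp add: field_simps flip: exp_add)
  have "1 + r\<^sup>2 \<le> m + m * (\<delta> / 4 * r\<^sup>2)"
  proof -
    have "1 \<le> m * (\<delta> / 4)" using assms by (auto simp: m_def field_simps max_def)
    then have "r\<^sup>2 * 1 \<le> r\<^sup>2 * (m * (\<delta> / 4))" by (intro mult_left_mono) auto
    moreover have "1 \<le> m" by (simp add: m_def)
    ultimately show ?thesis by (simp add: ac_simps)
  qed
  also have "\<dots> = m * (1 + \<delta> / 4 * r\<^sup>2)" by (simp add: algebra_simps)
  also have "\<dots> \<le> m * exp (\<delta> / 4 * r\<^sup>2)" by (intro mult_left_mono) (auto simp: m_def)
  finally have "(1 + r\<^sup>2) * exp (B * \<bar>r\<bar> - \<delta> * r\<^sup>2)
      \<le> (m * exp (\<delta> / 4 * r\<^sup>2)) * (exp (B\<^sup>2 / \<delta>) * exp (- (3 * \<delta> / 4) * r\<^sup>2))"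
    using e by (intro mult_mono) (auto simp: m_def)
  also have "\<dots> = m * exp (B\<^sup>2 / \<delta>) * (exp (\<delta> / 4 * r\<^sup>2) * exp (- (3 * \<delta> / 4) * r\<^sup>2))" by simp
  also have "\<dots> = m * exp (B\<^sup>2 / \<delta>) * exp (- (\<delta> / 2) * r\<^sup>2)"
    by (simp flip: exp_add)
  finally show "(1 + r\<^sup>2) * exp (B * \<bar>r\<bar> - \<delta> * r\<^sup>2)
      \<le> max 1 (4 / \<delta>) * exp (B\<^sup>2 / \<delta>) * exp (- (\<delta> / 2) * r\<^sup>2)" by (simp add: m_def)
qed

lemma gaussian_real:
  assumes "0 < (a::real)"
  shows integrable_gaussian_real: "integrable lborel (\<lambda>x::real. exp (- a * x\<^sup>2))"
    and integral_gaussian_real: "(LINT x::real|lborel. exp (- a * x\<^sup>2)) = sqrt (pi / a)"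
proof -
  define \<sigma> where "\<sigma> = sqrt (1 / (2 * a))"
  have s: "\<sigma> > 0" "2 * \<sigma>\<^sup>2 = 1 / a" using assms by (auto simp: \<sigma>_def field_simps)
  have eq: "exp (- a * x\<^sup>2) = sqrt (pi / a) * normal_density 0 \<sigma> x" for x
  proof -
    have "sqrt (2 * pi * \<sigma>\<^sup>2) = sqrt (pi / a)" using s(2) by (metis mult.assoc mult.commute divide_inverse mult_1 inverse_eq_divide)
    moreover have "x\<^sup>2 / (2 * \<sigma>\<^sup>2) = a * x\<^sup>2" by (simp add: s(2))
    ultimately show ?thesis using assms by (simp add: normal_density_def)
  qed
  show "integrable lborel (\<lambda>x::real. exp (- a * x\<^sup>2))"
    unfolding eq using s(1) by simp
  show "(LINT x::real|lborel. exp (- a * x\<^sup>2)) = sqrt (pi / a)"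
    unfolding eq using s(1) by simp
qed

lemma integrable_gaussian_euclidean:
  assumes "0 < a"
  shows "integrable lborel (\<lambda>x::'a::euclidean_space. exp (- a * (norm x)\<^sup>2))"
proof -
  have "exp (- a * (norm x)\<^sup>2) = (\<Prod>b\<in>Basis. exp (- a * (x \<bullet> b)\<^sup>2))" for x :: 'a
    unfolding power2_norm_eq_inner euclidean_inner[of x x]
    by (simp add: exp_sum[symmetric] sum_distrib_left power2_eq_square flip: sum_negf)
  then show ?thesis
    by (simp only:) (intro integrable_lborel_prod_Basis integrable_gaussian_real assms)
qed

section \<open>Complex Gaussian integrals\<close>

lemma integrable_gaussian_bound:
  fixes f :: "'a::euclidean_space \<Rightarrow> 'b::{banach, second_countable_topology}"
  assumes "f \<in> borel_measurable borel" "0 < \<delta>"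
    and "\<And>x. norm (f x) \<le> C * exp (- \<delta> * (norm x)\<^sup>2)"
  shows "integrable lborel f"
proof (rule Bochner_Integration.integrable_bound)
  show "integrable lborel (\<lambda>x::'a. C * exp (- \<delta> * (norm x)\<^sup>2))"
    by (intro integrable_mult_right integrable_gaussian_euclidean assms(2))
  show "AE x in lborel. norm (f x) \<le> norm (C * exp (- \<delta> * (norm x)\<^sup>2))"
    by (rule AE_I2) (use assms(3) order_trans[OF _ abs_ge_self] in \<open>simp only: real_norm_def, blast\<close>)
qed (use assms(1) in simp)

text \<open>For a shift by s b with |s| < 1 one has |x|^2 \<le> 2 |x + s b|^2 + 2 |b|^2, so half of
  the Gaussian decay survives uniformly in s; this supplies the majorant required for translation
  along b.\<close>

lemma integral_directional_derivative_gaussian: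
  fixes F F' :: "'a::euclidean_space \<Rightarrow> complex"
  assumes F: "integrable lborel F"
    and der: "\<And>x. ((\<lambda>s. F (x + s *\<^sub>R b)) has_vector_derivative F' x) (at 0)"
    and meas: "F' \<in> borel_measurable borel"
    and \<delta>: "0 < \<delta>" and bound: "\<And>x. norm (F' x) \<le> C * exp (- \<delta> * (norm x)\<^sup>2)"
  shows "(LINT x|lborel. F' x) = 0"
proof -
  let ?g = "\<lambda>x::'a. (C * exp (\<delta> * (norm b)\<^sup>2)) * exp (- (\<delta> / 2) * (norm x)\<^sup>2)"
  have g: "integrable lborel ?g"
    by (intro integrable_mult_right integrable_gaussian_euclidean) (use \<delta> in simp)
  have "norm (F' (x + s *\<^sub>R b)) \<le> ?g x" if s: "\<bar>s\<bar> < 1" for x s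
  proof -
    have C: "0 \<le> C" using order_trans[OF norm_ge_zero bound[of 0]] by simp
    have "norm x \<le> norm (x + s *\<^sub>R b) + norm b"
      using norm_triangle_ineq4[of "x + s *\<^sub>R b" "s *\<^sub>R b"] s mult_right_mono[of "\<bar>s\<bar>" 1 "norm b"] by simp
    then have "(norm x)\<^sup>2 \<le> (norm (x + s *\<^sub>R b) + norm b)\<^sup>2" by (intro power_mono) auto
    also have "\<dots> \<le> 2 * (norm (x + s *\<^sub>R b))\<^sup>2 + 2 * (norm b)\<^sup>2"
      using sum_squares_bound[of "norm (x + s *\<^sub>R b)" "norm b"] by (simp add: power2_sum)
    finally have "\<delta> * (norm x)\<^sup>2 \<le> \<delta> * (2 * (norm (x + s *\<^sub>R b))\<^sup>2 + 2 * (norm b)\<^sup>2)"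
      using \<delta> by simp
    then have "exp (- \<delta> * (norm (x + s *\<^sub>R b))\<^sup>2) \<le> exp (\<delta> * (norm b)\<^sup>2) * exp (- (\<delta> / 2) * (norm x)\<^sup>2)"
      unfolding exp_add[symmetric] exp_le_cancel_iff by (simp add: algebra_simps)
    then have "C * exp (- \<delta> * (norm (x + s *\<^sub>R b))\<^sup>2) \<le> ?g x"
      using C by (simp add: mult_left_mono mult.assoc)
    then show ?thesis by (rule order_trans[OF bound])
  qed
  then show ?thesis
    using integral_directional_derivative_eq_0[where F = F and b = b and g = ?g, OF F der _ g meas] by simp
qed

definition gauss_exp :: "complex \<Rightarrow> complex \<Rightarrow> real \<Rightarrow> complex" where
  "gauss_exp a b x = exp (- a * of_real (x\<^sup>2) + b * of_real x)"

lemma norm_gauss_exp_le: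
  assumes "\<delta> \<le> Re a" "norm b \<le> B"
  shows "norm (gauss_exp a b x) \<le> exp (B * \<bar>x\<bar> - \<delta> * x\<^sup>2)"
proof -
  have "Re b * x \<le> norm b * \<bar>x\<bar>"
    using abs_ge_self[of "Re b * x"] mult_right_mono[OF abs_Re_le_cmod[of b], of "\<bar>x\<bar>"]
    by (simp add: abs_mult)
  also have "\<dots> \<le> B * \<bar>x\<bar>" using assms(2) by (simp add: mult_right_mono)
  finally have "Re b * x \<le> B * \<bar>x\<bar>" .
  moreover have "\<delta> * x\<^sup>2 \<le> Re a * x\<^sup>2" using assms(1) by (simp add: mult_right_mono)
  ultimately show ?thesis by (simp add: gauss_exp_def)
qed

lemma gauss_exp_measurable [measurable]: "gauss_exp a b \<in> borel_measurable borel"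
  unfolding gauss_exp_def by measurable

lemma poly_gauss_exp_bound:
  assumes "0 < Re a"
  shows "\<exists>C. \<forall>x. (1 + x\<^sup>2) * norm (gauss_exp a b x) \<le> C * exp (- (Re a / 2) * x\<^sup>2)"
proof -
  obtain C where C: "\<And>r. (1 + r\<^sup>2) * exp (norm b * \<bar>r\<bar> - Re a * r\<^sup>2) \<le> C * exp (- (Re a / 2) * r\<^sup>2)"
    using gaussian_absorbs[OF assms, of "norm b"] by blast
  have "(1 + x\<^sup>2) * norm (gauss_exp a b x) \<le> C * exp (- (Re a / 2) * x\<^sup>2)" for x
    using C[of x] norm_gauss_exp_le[of "Re a" a b "norm b" x]
    by (meson add_nonneg_nonneg mult_left_mono order_refl order_trans zero_le_one zero_le_power2)
  then show ?thesis by blast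
qed

lemma
  assumes "0 < Re a"
    and p: "p \<in> borel_measurable borel" "\<And>x. norm (p x) \<le> K * (1 + x\<^sup>2)"
  shows integrable_poly_gauss_exp: "integrable lborel (\<lambda>x. p x * gauss_exp a b x)"
    and bound_poly_gauss_exp:
      "\<exists>C. \<forall>x. norm (p x * gauss_exp a b x) \<le> C * exp (- (Re a / 2) * (norm x)\<^sup>2)"
proof -
  obtain C where C: "\<And>x. (1 + x\<^sup>2) * norm (gauss_exp a b x) \<le> C * exp (- (Re a / 2) * x\<^sup>2)"
    using poly_gauss_exp_bound[OF assms(1)] by blast
  have K: "0 \<le> K" using order_trans[OF norm_ge_zero p(2)[of 0]] by simp
  have "norm (p x * gauss_exp a b x) \<le> (K * C) * exp (- (Re a / 2) * (norm x)\<^sup>2)" for x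
  proof -
    have "norm (p x * gauss_exp a b x) \<le> K * ((1 + x\<^sup>2) * norm (gauss_exp a b x))"
      using p(2)[of x] by (simp add: norm_mult mult_right_mono flip: mult.assoc)
    also have "\<dots> \<le> K * (C * exp (- (Re a / 2) * x\<^sup>2))" using K C by (intro mult_left_mono) auto
    finally show ?thesis by simp
  qed
  then show 2: "\<exists>C. \<forall>x. norm (p x * gauss_exp a b x) \<le> C * exp (- (Re a / 2) * (norm x)\<^sup>2)" by blast
  show "integrable lborel (\<lambda>x. p x * gauss_exp a b x)"
    using 2 p(1) assms(1) integrable_gaussian_bound[of "\<lambda>x. p x * gauss_exp a b x" "Re a / 2"] by auto
qed

lemma abs_le_one_plus_square: "\<bar>x\<bar> \<le> 1 + x\<^sup>2" for x :: real
  using sum_squares_bound[of "\<bar>x\<bar>" 1] zero_le_power2[of x] by (simp add: abs_if split: if_splits)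

text \<open>Integration by parts: the derivatives (b - 2 a x) e and (1 + b x - 2 a x^2) e of e and x
  e, with e = \<open>gauss_exp a b\<close>, have integral zero. These are two linear equations that
  express the moments of order 1 and 2 through the integral of e.\<close>

lemma gauss_exp_moments:
  assumes a: "0 < Re a"
  shows integrable_gauss_exp: "integrable lborel (gauss_exp a b)"
    and integrable_gauss_exp_1: "integrable lborel (\<lambda>x. of_real x * gauss_exp a b x)"
    and integrable_gauss_exp_2: "integrable lborel (\<lambda>x. of_real (x\<^sup>2) * gauss_exp a b x)"
    and gauss_exp_moment_1: "(LINT x|lborel. of_real x * gauss_exp a b x)
      = b / (2 * a) * (LINT x|lborel. gauss_exp a b x)"
    and gauss_exp_moment_2: "(LINT x|lborel. of_real (x\<^sup>2) * gauss_exp a b x)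
      = (1 / (2 * a) + b\<^sup>2 / (4 * a\<^sup>2)) * (LINT x|lborel. gauss_exp a b x)"
proof -
  let ?e = "gauss_exp a b"
  have a0: "a \<noteq> 0" using a by auto
  show i0: "integrable lborel ?e"
    using integrable_poly_gauss_exp[OF a, of "\<lambda>_. 1" 1] by simp
  show i1: "integrable lborel (\<lambda>x. of_real x * ?e x)"
    by (rule integrable_poly_gauss_exp[OF a, where K = 1]) (auto simp: abs_le_one_plus_square)
  show i2: "integrable lborel (\<lambda>x. of_real (x\<^sup>2) * ?e x)"
    by (rule integrable_poly_gauss_exp[OF a, where K = 1]) (auto simp: norm_power)
  have der: "(?e has_vector_derivative (- 2 * a * of_real x + b) * ?e x) (at x)" for x
  proof -
    have "((\<lambda>z. exp (- a * z\<^sup>2 + b * z)) has_field_derivative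
        (- 2 * a * of_real x + b) * exp (- a * (of_real x)\<^sup>2 + b * of_real x)) (at (of_real x))"
      by (auto intro!: derivative_eq_intros)
    then show ?thesis
      unfolding gauss_exp_def of_real_power by (rule has_vector_derivative_real_field)
  qed
  \<comment> \<open>The real line is treated as a Euclidean space with the single direction 1, to
    reuse the lemma on directional derivatives.\<close>
  have der': "((\<lambda>s. F (x + s *\<^sub>R 1)) has_vector_derivative D) (at 0)"
    if "(F has_vector_derivative D) (at x)" for F :: "real \<Rightarrow> complex" and x D
    using that unfolding has_vector_derivative_iff_quotient by simp
  define K where "K = 2 * norm a + norm b + 1"
  have b1: "norm (- 2 * a * of_real x + b) \<le> K * (1 + x\<^sup>2)" for x
  proof -
    have "norm (- 2 * a * of_real x + b) \<le> 2 * norm a * \<bar>x\<bar> + norm b * 1"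
      using norm_triangle_ineq[of "- 2 * a * of_real x" b] by (simp add: norm_mult)
    also have "\<dots> \<le> 2 * norm a * (1 + x\<^sup>2) + norm b * (1 + x\<^sup>2)"
      by (intro add_mono mult_left_mono abs_le_one_plus_square) auto
    also have "\<dots> \<le> K * (1 + x\<^sup>2)" by (simp add: K_def algebra_simps)
    finally show ?thesis .
  qed
  have b2: "norm (1 + (- 2 * a * of_real (x\<^sup>2) + b * of_real x)) \<le> K * (1 + x\<^sup>2)" for x
  proof -
    have "norm (1 + (- 2 * a * of_real (x\<^sup>2) + b * of_real x))
        \<le> 1 + (norm (- 2 * a * of_real (x\<^sup>2)) + norm (b * of_real x))"
      using norm_triangle_ineq[of 1 "- 2 * a * of_real (x\<^sup>2) + b * of_real x"]
        norm_triangle_ineq[of "- 2 * a * of_real (x\<^sup>2)" "b * of_real x"] by simp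
    also have "\<dots> = 1 + (2 * norm a * x\<^sup>2 + norm b * \<bar>x\<bar>)" by (simp add: norm_mult norm_power)
    also have "\<dots> \<le> 1 * (1 + x\<^sup>2) + (2 * norm a * (1 + x\<^sup>2) + norm b * (1 + x\<^sup>2))"
      by (intro add_mono mult_left_mono abs_le_one_plus_square) auto
    also have "\<dots> = K * (1 + x\<^sup>2)" by (simp add: K_def algebra_simps)
    finally show ?thesis .
  qed
  obtain C1 where C1: "\<And>x. norm ((- 2 * a * of_real x + b) * ?e x) \<le> C1 * exp (- (Re a / 2) * (norm x)\<^sup>2)"
    using bound_poly_gauss_exp[OF a _ b1, of b] by auto
  obtain C2 where C2: "\<And>x. norm ((1 + (- 2 * a * of_real (x\<^sup>2) + b * of_real x)) * ?e x)
      \<le> C2 * exp (- (Re a / 2) * (norm x)\<^sup>2)"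
    using bound_poly_gauss_exp[OF a _ b2, of b] by auto
  have "(LINT x|lborel. (- 2 * a * of_real x + b) * ?e x) = 0"
    by (rule integral_directional_derivative_gaussian[OF i0 der'[OF der] _ _ C1]) (use a in auto)
  moreover have "(LINT x|lborel. (- 2 * a * of_real x + b) * ?e x)
      = (LINT x|lborel. - 2 * a * (of_real x * ?e x) + b * ?e x)"
    by (simp add: algebra_simps)
  ultimately have m1: "- 2 * a * (LINT x|lborel. of_real x * ?e x) + b * (LINT x|lborel. ?e x) = 0"
    using i0 i1 by simp
  then show M1: "(LINT x|lborel. of_real x * ?e x) = b / (2 * a) * (LINT x|lborel. ?e x)"
    using a0 by (simp add: field_simps)
  have "((\<lambda>x. of_real x * ?e x) has_vector_derivative
      (1 + (- 2 * a * of_real (x\<^sup>2) + b * of_real x)) * ?e x) (at x)" for x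
  proof -
    have "((\<lambda>x. of_real x * ?e x) has_vector_derivative
        of_real x * ((- 2 * a * of_real x + b) * ?e x) + of_real 1 * ?e x) (at x)"
      by (rule has_vector_derivative_mult[OF has_vector_derivative_of_real[OF DERIV_ident] der])
    then show ?thesis by (simp add: algebra_simps power2_eq_square)
  qed
  from this[THEN der'] have
    "(LINT x|lborel. (1 + (- 2 * a * of_real (x\<^sup>2) + b * of_real x)) * ?e x) = 0"
    by (rule integral_directional_derivative_gaussian[OF i1 _ _ _ C2]) (use a in auto)
  moreover have "(LINT x|lborel. (1 + (- 2 * a * of_real (x\<^sup>2) + b * of_real x)) * ?e x)
      = (LINT x|lborel. ?e x + (- 2 * a * (of_real (x\<^sup>2) * ?e x) + b * (of_real x * ?e x)))"
    by (simp add: algebra_simps)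
  ultimately have "(LINT x|lborel. ?e x) + (- 2 * a * (LINT x|lborel. of_real (x\<^sup>2) * ?e x)
      + b * (LINT x|lborel. of_real x * ?e x)) = 0"
    using i0 i1 i2 by (simp del: of_real_power)
  then show "(LINT x|lborel. of_real (x\<^sup>2) * ?e x)
      = (1 / (2 * a) + b\<^sup>2 / (4 * a\<^sup>2)) * (LINT x|lborel. ?e x)"
    unfolding M1 using a0 by (simp add: field_simps power2_eq_square)
qed

text \<open>Near \<open>\<tau>\<^sub>0\<close> the real part of the quadratic coefficient stays
  above half its value and the linear coefficient stays bounded, so \<open>gaussian_absorbs\<close>
  gives a single majorant for the derivatives of the integrand.\<close>

lemma has_vector_derivative_integral_gauss_exp:
  fixes \<tau>\<^sub>0 :: real and a' b' a0 b0 :: complex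
  defines "\<alpha> \<equiv> \<lambda>\<tau>. a0 + of_real \<tau> * a'" and "\<beta> \<equiv> \<lambda>\<tau>. b0 + of_real \<tau> * b'"
  assumes pos: "0 < Re (\<alpha> \<tau>\<^sub>0)"
  shows "((\<lambda>\<tau>. LINT x|lborel. gauss_exp (\<alpha> \<tau>) (\<beta> \<tau>) x) has_vector_derivative
    (LINT x|lborel. (- a' * of_real (x\<^sup>2) + b' * of_real x) * gauss_exp (\<alpha> \<tau>\<^sub>0) (\<beta> \<tau>\<^sub>0) x)) (at \<tau>\<^sub>0)"
proof -
  define \<delta> where "\<delta> = Re (\<alpha> \<tau>\<^sub>0) / 2"
  define B where "B = norm (\<beta> \<tau>\<^sub>0) + norm b'"
  \<comment> \<open>The second entry limits the drift of the real part of \<alpha> to \<delta>, half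
    its initial value; the first limits the drift of \<beta> to |b'|. The summand 1 keeps the
    denominator positive when a' = 0.\<close>
  define r where "r = min 1 (\<delta> / (norm a' + 1))"
  have \<delta>: "0 < \<delta>" using pos by (simp add: \<delta>_def)
  have n1: "norm a' + 1 > 0" using norm_ge_zero[of a'] by linarith
  have r: "0 < r" using \<delta> n1 by (simp add: r_def)
  have A: "\<delta> \<le> Re (\<alpha> \<tau>)" if "\<bar>\<tau> - \<tau>\<^sub>0\<bar> < r" for \<tau>
  proof -
    have "\<bar>Re (\<alpha> \<tau>) - Re (\<alpha> \<tau>\<^sub>0)\<bar> = \<bar>\<tau> - \<tau>\<^sub>0\<bar> * \<bar>Re a'\<bar>"
      by (simp add: \<alpha>_def algebra_simps flip: abs_mult)
    also have "\<dots> \<le> r * (norm a' + 1)"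
      using that r abs_Re_le_cmod[of a'] by (intro mult_mono) auto
    also have "\<dots> \<le> \<delta> / (norm a' + 1) * (norm a' + 1)"
      by (intro mult_right_mono) (auto simp: r_def)
    also have "\<dots> = \<delta>" using n1 by simp
    finally have "\<bar>Re (\<alpha> \<tau>) - Re (\<alpha> \<tau>\<^sub>0)\<bar> \<le> Re (\<alpha> \<tau>\<^sub>0) / 2" by (simp add: \<delta>_def)
    then show ?thesis unfolding \<delta>_def by linarith
  qed
  have Bb: "norm (\<beta> \<tau>) \<le> B" if "\<bar>\<tau> - \<tau>\<^sub>0\<bar> < r" for \<tau>
  proof -
    have "\<beta> \<tau> = \<beta> \<tau>\<^sub>0 + of_real (\<tau> - \<tau>\<^sub>0) * b'" by (simp add: \<beta>_def algebra_simps)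
    then have "norm (\<beta> \<tau>) \<le> norm (\<beta> \<tau>\<^sub>0) + \<bar>\<tau> - \<tau>\<^sub>0\<bar> * norm b'"
      by (metis norm_triangle_ineq norm_mult norm_of_real)
    also have "\<bar>\<tau> - \<tau>\<^sub>0\<bar> * norm b' \<le> 1 * norm b'"
      using that by (intro mult_right_mono) (auto simp: r_def)
    finally show ?thesis by (simp add: B_def)
  qed
  obtain C where C: "\<And>x. (1 + x\<^sup>2) * exp (B * \<bar>x\<bar> - \<delta> * x\<^sup>2) \<le> C * exp (- (\<delta> / 2) * x\<^sup>2)"
    using gaussian_absorbs[OF \<delta>] by blast
  let ?K = "norm a' + norm b'"
  show ?thesis
  proof (rule has_vector_derivative_integral[where r = r and
      g = "\<lambda>x. ?K * (C * exp (- (\<delta> / 2) * x\<^sup>2))"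
      and f' = "\<lambda>\<tau> x. (- a' * of_real (x\<^sup>2) + b' * of_real x) * gauss_exp (\<alpha> \<tau>) (\<beta> \<tau>) x"])
    fix s x :: real assume s: "\<bar>s - \<tau>\<^sub>0\<bar> < r"
    show "integrable lborel (gauss_exp (\<alpha> s) (\<beta> s))"
      using A[OF s] \<delta> by (intro integrable_gauss_exp) simp
    show "((\<lambda>s. gauss_exp (\<alpha> s) (\<beta> s) x) has_vector_derivative
        (- a' * of_real (x\<^sup>2) + b' * of_real x) * gauss_exp (\<alpha> s) (\<beta> s) x) (at s)"
    proof -
      have "((\<lambda>z. exp (- (a0 + z * a') * of_real (x\<^sup>2) + (b0 + z * b') * of_real x)) has_field_derivative
          (- a' * of_real (x\<^sup>2) + b' * of_real x) *
            exp (- (a0 + of_real s * a') * of_real (x\<^sup>2) + (b0 + of_real s * b') * of_real x)) (at (of_real s))"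
        by (auto intro!: derivative_eq_intros)
      then show ?thesis
        unfolding gauss_exp_def \<alpha>_def \<beta>_def by (rule has_vector_derivative_real_field)
    qed
    have "norm (- a' * of_real (x\<^sup>2) + b' * of_real x) \<le> norm a' * x\<^sup>2 + norm b' * \<bar>x\<bar>"
      using norm_triangle_ineq[of "- a' * of_real (x\<^sup>2)" "b' * of_real x"]
      by (simp add: norm_mult norm_power)
    also have "\<dots> \<le> norm a' * (1 + x\<^sup>2) + norm b' * (1 + x\<^sup>2)"
      by (intro add_mono mult_left_mono abs_le_one_plus_square) auto
    finally have "norm (- a' * of_real (x\<^sup>2) + b' * of_real x) \<le> ?K * (1 + x\<^sup>2)"
      by (simp add: algebra_simps)
    then have "norm ((- a' * of_real (x\<^sup>2) + b' * of_real x) * gauss_exp (\<alpha> s) (\<beta> s) x)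
        \<le> (?K * (1 + x\<^sup>2)) * exp (B * \<bar>x\<bar> - \<delta> * x\<^sup>2)"
      unfolding norm_mult using norm_gauss_exp_le[OF A[OF s] Bb[OF s], of x] by (intro mult_mono) auto
    also have "\<dots> \<le> ?K * (C * exp (- (\<delta> / 2) * x\<^sup>2))"
      using C[of x] unfolding mult.assoc by (intro mult_left_mono) auto
    finally show "norm ((- a' * of_real (x\<^sup>2) + b' * of_real x) * gauss_exp (\<alpha> s) (\<beta> s) x)
        \<le> ?K * (C * exp (- (\<delta> / 2) * x\<^sup>2))" .
  qed (use r \<delta> integrable_gaussian_real[of "\<delta> / 2"] in auto)
qed

lemma DERIV_exp_neg_square_divide:
  fixes f g :: "complex \<Rightarrow> complex"
  assumes "(f has_field_derivative f') (at z)" "(g has_field_derivative g') (at z)" "g z \<noteq> 0"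
  shows "((\<lambda>z. exp (- (f z)\<^sup>2 / (4 * g z))) has_field_derivative
    exp (- (f z)\<^sup>2 / (4 * g z)) * (- f z * f' / (2 * g z) + (f z)\<^sup>2 * g' / (4 * (g z)\<^sup>2))) (at z)"
proof -
  have "((\<lambda>z. - (f z)\<^sup>2 / (4 * g z)) has_field_derivative
      ((- (2 * f z * f')) * (4 * g z) - (- (f z)\<^sup>2) * (4 * g')) / ((4 * g z) * (4 * g z))) (at z)"
    by (rule DERIV_divide) (use assms in \<open>auto intro!: derivative_eq_intros\<close>)
  also have "((- (2 * f z * f')) * (4 * g z) - (- (f z)\<^sup>2) * (4 * g')) / ((4 * g z) * (4 * g z))
      = - f z * f' / (2 * g z) + (f z)\<^sup>2 * g' / (4 * (g z)\<^sup>2)"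
    using assms(3) by (simp add: divide_simps power2_eq_square)
  finally show ?thesis by (rule DERIV_fun_exp)
qed

text \<open>Along the segment from \<open>(1, 0)\<close> to \<open>(a, b)\<close> the integral solves the same linear
  differential equation as the right-hand side.\<close>

lemma integral_gauss_exp:
  assumes a: "0 < Re a"
  shows "(LINT x|lborel. gauss_exp a b x) = of_real (sqrt pi) / csqrt a * exp (b\<^sup>2 / (4 * a))"
proof -
  define \<alpha> where "\<alpha> = (\<lambda>\<tau>::real. 1 + of_real \<tau> * (a - 1))"
  define \<beta> where "\<beta> = (\<lambda>\<tau>::real. 0 + of_real \<tau> * b)"
  define \<Phi> where "\<Phi> = (\<lambda>\<tau>. LINT x|lborel. gauss_exp (\<alpha> \<tau>) (\<beta> \<tau>) x)"
  \<comment> \<open>Up to the factor sqrt pi this is the reciprocal of the claimed value, so the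
    claim becomes that \<Phi> h is constant.\<close>
  define h where "h = (\<lambda>\<tau>. csqrt (\<alpha> \<tau>) * exp (- (\<beta> \<tau>)\<^sup>2 / (4 * \<alpha> \<tau>)))"
  have "((\<lambda>\<tau>. \<Phi> \<tau> * h \<tau>) has_derivative (\<lambda>_. 0)) (at \<tau> within {0..1})"
    if \<tau>: "\<tau> \<in> {0..1}" for \<tau>
  proof -
    \<comment> \<open>By convexity the segment stays in the right half-plane, where the integral
      converges and \<open>csqrt\<close> is holomorphic.\<close>
    have pos: "0 < Re (\<alpha> \<tau>)"
    proof -
      have "Re (\<alpha> \<tau>) = (1 - \<tau>) + \<tau> * Re a" by (simp add: \<alpha>_def algebra_simps)
      moreover have "0 < (1 - \<tau>) + \<tau> * Re a"
        using \<tau> a by (cases "\<tau> = 0") (auto intro: add_nonneg_pos)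
      ultimately show ?thesis by simp
    qed
    then have \<alpha>0: "\<alpha> \<tau> \<noteq> 0" and nr: "\<alpha> \<tau> \<notin> \<real>\<^sub>\<le>\<^sub>0"
      by (auto simp: complex_nonpos_Reals_iff)
    have sq: "csqrt (\<alpha> \<tau>) * csqrt (\<alpha> \<tau>) = \<alpha> \<tau>" by (metis power2_csqrt power2_eq_square)
    note i = gauss_exp_moments[OF pos, of "\<beta> \<tau>"]
    have "(\<Phi> has_vector_derivative
        (LINT x|lborel. (- (a - 1) * of_real (x\<^sup>2) + b * of_real x) * gauss_exp (\<alpha> \<tau>) (\<beta> \<tau>) x)) (at \<tau>)"
      unfolding \<Phi>_def \<alpha>_def \<beta>_def
      by (rule has_vector_derivative_integral_gauss_exp) (use pos in \<open>simp add: \<alpha>_def\<close>)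
    also have "(LINT x|lborel. (- (a - 1) * of_real (x\<^sup>2) + b * of_real x) * gauss_exp (\<alpha> \<tau>) (\<beta> \<tau>) x)
        = (LINT x|lborel. - (a - 1) * (of_real (x\<^sup>2) * gauss_exp (\<alpha> \<tau>) (\<beta> \<tau>) x)
            + b * (of_real x * gauss_exp (\<alpha> \<tau>) (\<beta> \<tau>) x))"
      by (simp only: distrib_right mult.assoc)
    also have "\<dots> = - (a - 1) * ((1 / (2 * \<alpha> \<tau>) + (\<beta> \<tau>)\<^sup>2 / (4 * (\<alpha> \<tau>)\<^sup>2)) * \<Phi> \<tau>)
        + b * (\<beta> \<tau> / (2 * \<alpha> \<tau>) * \<Phi> \<tau>)"
      unfolding \<Phi>_def i(4,5)[symmetric] using i(2,3) by (simp del: of_real_power)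
    finally have d1: "(\<Phi> has_vector_derivative \<dots>) (at \<tau>)" .
    have d\<alpha>: "(\<alpha> has_vector_derivative (a - 1)) (at \<tau>)"
      unfolding \<alpha>_def by (auto intro!: derivative_eq_intros simp: has_vector_derivative_def scaleR_conv_of_real)
    have d\<beta>: "(\<beta> has_vector_derivative b) (at \<tau>)"
      unfolding \<beta>_def by (auto intro!: derivative_eq_intros simp: has_vector_derivative_def scaleR_conv_of_real)
    have dsq: "((\<lambda>\<tau>. csqrt (\<alpha> \<tau>)) has_vector_derivative ((a - 1) * (1 / (2 * csqrt (\<alpha> \<tau>))))) (at \<tau>)"
      using field_vector_diff_chain_at[OF d\<alpha> has_field_derivative_csqrt[OF nr]]
      by (simp add: comp_def inverse_eq_divide)
    have dex: "((\<lambda>\<tau>. exp (- (\<beta> \<tau>)\<^sup>2 / (4 * \<alpha> \<tau>))) has_vector_derivative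
        exp (- (\<beta> \<tau>)\<^sup>2 / (4 * \<alpha> \<tau>)) * (- \<beta> \<tau> * b / (2 * \<alpha> \<tau>) + (\<beta> \<tau>)\<^sup>2 * (a - 1) / (4 * (\<alpha> \<tau>)\<^sup>2))) (at \<tau>)"
      unfolding \<alpha>_def \<beta>_def
      by (rule has_vector_derivative_real_field[OF DERIV_exp_neg_square_divide])
        (use \<alpha>0 in \<open>auto intro!: derivative_eq_intros simp: \<alpha>_def\<close>)
    have "((\<lambda>\<tau>. \<Phi> \<tau> * h \<tau>) has_vector_derivative 0) (at \<tau>)"
      unfolding h_def
    proof (rule has_vector_derivative_eq_rhs[OF has_vector_derivative_mult[OF d1
            has_vector_derivative_mult[OF dsq dex]]])
      \<comment> \<open>With the root in the numerator every term carries the same factor, and the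
        remaining rational terms cancel.\<close>
      have inv: "1 / (2 * csqrt (\<alpha> \<tau>)) = csqrt (\<alpha> \<tau>) / (2 * \<alpha> \<tau>)"
        using \<alpha>0 sq by (simp add: divide_simps)
      show "\<Phi> \<tau> * (csqrt (\<alpha> \<tau>) * (exp (- (\<beta> \<tau>)\<^sup>2 / (4 * \<alpha> \<tau>)) *
            (- \<beta> \<tau> * b / (2 * \<alpha> \<tau>) + (\<beta> \<tau>)\<^sup>2 * (a - 1) / (4 * (\<alpha> \<tau>)\<^sup>2)))
          + (a - 1) * (1 / (2 * csqrt (\<alpha> \<tau>))) * exp (- (\<beta> \<tau>)\<^sup>2 / (4 * \<alpha> \<tau>)))
        + (- (a - 1) * ((1 / (2 * \<alpha> \<tau>) + (\<beta> \<tau>)\<^sup>2 / (4 * (\<alpha> \<tau>)\<^sup>2)) * \<Phi> \<tau>)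
          + b * (\<beta> \<tau> / (2 * \<alpha> \<tau>) * \<Phi> \<tau>)) * (csqrt (\<alpha> \<tau>) * exp (- (\<beta> \<tau>)\<^sup>2 / (4 * \<alpha> \<tau>))) = 0"
        unfolding inv by (simp add: algebra_simps add_divide_distrib diff_divide_distrib)
    qed
    then show ?thesis
      unfolding has_vector_derivative_def by (auto intro: has_derivative_at_withinI)
  qed
  then obtain c where c: "\<And>\<tau>. \<tau> \<in> {0..1} \<Longrightarrow> \<Phi> \<tau> * h \<tau> = c"
    using has_derivative_zero_constant[of "{0..1::real}" "\<lambda>\<tau>. \<Phi> \<tau> * h \<tau>"] by auto
  have "\<Phi> 0 = of_real (LINT x|lborel. exp (- 1 * x\<^sup>2))"
    unfolding \<Phi>_def gauss_exp_def \<alpha>_def \<beta>_def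
    by (subst integral_complex_of_real[symmetric]) (simp add: exp_of_real[symmetric])
  then have "\<Phi> 0 = of_real (sqrt pi)" by (simp only: integral_gaussian_real) simp
  moreover have "h 0 = 1" by (simp add: h_def \<alpha>_def \<beta>_def)
  ultimately have "\<Phi> 1 * h 1 = of_real (sqrt pi)" using c[of 0] c[of 1] by simp
  moreover have "h 1 = csqrt a * exp (- (b\<^sup>2 / (4 * a)))" "\<Phi> 1 = (LINT x|lborel. gauss_exp a b x)"
    by (auto simp: h_def \<Phi>_def \<alpha>_def \<beta>_def)
  moreover have "csqrt a \<noteq> 0" using a by auto
  ultimately show ?thesis by (simp add: exp_minus field_simps)
qed

text \<open>The integrand factors over the coordinates. Allowing c to be complex includes c = i and
  c = -i, that is, Fourier transforms of Gaussians.\<close>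

lemma integral_gaussian_linear:
  fixes \<eta> :: "'a::euclidean_space"
  assumes a: "0 < Re a"
  shows "(LINT x|lborel. exp (- a * of_real ((norm x)\<^sup>2) + c * of_real (\<eta> \<bullet> x)))
        = (of_real (sqrt pi) / csqrt a) ^ DIM('a) * exp (c\<^sup>2 * of_real ((norm \<eta>)\<^sup>2) / (4 * a))"
proof -
  have eq: "exp (- a * of_real ((norm x)\<^sup>2) + c * of_real (\<eta> \<bullet> x))
      = (\<Prod>b\<in>Basis. gauss_exp a (c * of_real (\<eta> \<bullet> b)) (x \<bullet> b))" for x :: 'a
    unfolding gauss_exp_def exp_sum[OF finite_Basis, symmetric] power2_norm_eq_inner
      euclidean_inner[of x x] euclidean_inner[of \<eta> x]
    by (simp add: sum.distrib sum_distrib_left sum_negf sum_subtractf power2_eq_square mult.assoc)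
  have "(\<Prod>b\<in>(Basis::'a set). exp ((c * of_real (\<eta> \<bullet> b))\<^sup>2 / (4 * a)))
      = exp (c\<^sup>2 * of_real ((norm \<eta>)\<^sup>2) / (4 * a))"
    unfolding exp_sum[OF finite_Basis, symmetric] power2_norm_eq_inner euclidean_inner[of \<eta> \<eta>]
    by (simp add: sum_divide_distrib sum_distrib_left power_mult_distrib power2_eq_square mult_ac)
  then show ?thesis
    unfolding eq
    by (subst integral_lborel_prod_Basis[OF integrable_gauss_exp[OF a]])
      (simp only: integral_gauss_exp[OF a] prod.distrib prod_constant)
qed

section \<open>Injectivity of the Fourier transform on integrable functions\<close>

lemma Fubini_dominated:
  fixes F :: "'a::euclidean_space \<Rightarrow> 'b::euclidean_space \<Rightarrow> complex"
  assumes [measurable]: "case_prod F \<in> borel_measurable (lborel \<Otimes>\<^sub>M lborel)"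
    and p: "integrable lborel p" and q: "integrable lborel q"
    and le: "\<And>x y. norm (F x y) \<le> p x * q y"
  shows "(LINT y|lborel. LINT x|lborel. F x y) = (LINT x|lborel. LINT y|lborel. F x y)"
proof (rule lborel_pair.Fubini_integral)
  have [measurable]: "p \<in> borel_measurable borel" "q \<in> borel_measurable borel"
    using p q by auto
  have "integrable (lborel \<Otimes>\<^sub>M lborel) (\<lambda>(x, y). p x * q y)"
  proof (rule lborel_pair.Fubini_integrable)
    show "integrable lborel (\<lambda>x. LINT y|lborel. norm (case (x, y) of (x, y) \<Rightarrow> p x * q y))"
      using p by (simp add: abs_mult)
  qed (use q in auto)
  then show "integrable (lborel \<Otimes>\<^sub>M lborel) (case_prod F)"
    by (rule Bochner_Integration.integrable_bound) (auto intro!: AE_I2 order_trans[OF le abs_ge_self])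
qed

lemma integral_affine:
  fixes f :: "'a::euclidean_space \<Rightarrow> complex"
  assumes [measurable]: "f \<in> borel_measurable borel" and c: "c \<noteq> 0"
  shows "(LINT y|lborel. f y) = \<bar>c\<bar> ^ DIM('a) *\<^sub>R (LINT z|lborel. f (t + c *\<^sub>R z))"
proof -
  have "(LINT y|lborel. f y)
      = (LINT y|density (distr lborel borel (\<lambda>x. t + c *\<^sub>R x)) (\<lambda>_. ennreal (\<bar>c\<bar> ^ DIM('a))). f y)"
    using lborel_affine[OF c, of t] by simp
  also have "\<dots> = (LINT z|lborel. (\<bar>c\<bar> ^ DIM('a)) *\<^sub>R f (t + c *\<^sub>R z))"
    by (subst integral_density) (auto simp: integral_distr)
  finally show ?thesis by simp
qed

text \<open>A Gaussian in x - y is itself a superposition of characters with an integrable Gaussian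
  weight. After exchanging the integrals, the inner one is a value of the Fourier transform of k,
  which vanishes.\<close>

lemma integral_gaussian_convolution_eq_0:
  fixes k :: "'a::euclidean_space \<Rightarrow> complex"
  assumes k: "integrable lborel k"
    and zero: "\<And>\<xi>. (LINT x|lborel. k x * exp (- \<i> * of_real (\<xi> \<bullet> x))) = 0"
    and s: "0 < s"
  shows "(LINT x|lborel. k x * of_real (exp (- s * (norm (x - y))\<^sup>2))) = 0"
proof -
  have [measurable]: "k \<in> borel_measurable borel" using k by auto
  \<comment> \<open>The Fourier integral of e^(-\<epsilon> |\<xi>|^2) is a multiple of a Gaussian
    with exponent 1/(4 \<epsilon>), which has to be s.\<close>
  define \<epsilon> where "\<epsilon> = 1 / (4 * s)"
  have \<epsilon>: "0 < \<epsilon>" using s by (simp add: \<epsilon>_def)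
  define c where "c = (complex_of_real (sqrt pi) / csqrt \<epsilon>) ^ DIM('a)"
  have c0: "c \<noteq> 0" using \<epsilon> by (simp add: c_def)
  let ?F = "\<lambda>x \<xi>. k x * exp (- of_real \<epsilon> * of_real ((norm \<xi>)\<^sup>2) + \<i> * of_real ((y - x) \<bullet> \<xi>))"
  have fub: "(LINT \<xi>|lborel. LINT x|lborel. ?F x \<xi>) = (LINT x|lborel. LINT \<xi>|lborel. ?F x \<xi>)"
  proof (rule Fubini_dominated)
    show "integrable lborel (\<lambda>x. norm (k x))" using k by simp
    show "integrable lborel (\<lambda>\<xi>::'a. exp (- \<epsilon> * (norm \<xi>)\<^sup>2))"
      by (rule integrable_gaussian_euclidean[OF \<epsilon>])
    show "norm (?F x \<xi>) \<le> norm (k x) * exp (- \<epsilon> * (norm \<xi>)\<^sup>2)" for x \<xi>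
      by (simp add: norm_mult)
  qed measurable
  have inner0: "(LINT x|lborel. ?F x \<xi>) = 0" for \<xi>
  proof -
    have "?F x \<xi> = exp (- of_real \<epsilon> * of_real ((norm \<xi>)\<^sup>2) + \<i> * of_real (y \<bullet> \<xi>)) *
        (k x * exp (- \<i> * of_real (\<xi> \<bullet> x)))" for x
      by (simp add: inner_diff_left inner_commute[of \<xi> x] algebra_simps flip: exp_add)
    then have "(LINT x|lborel. ?F x \<xi>) = (LINT x|lborel. exp (- of_real \<epsilon> * of_real ((norm \<xi>)\<^sup>2) + \<i> * of_real (y \<bullet> \<xi>)) *
        (k x * exp (- \<i> * of_real (\<xi> \<bullet> x))))" by (rule Bochner_Integration.integral_cong[OF refl])
    then show ?thesis unfolding integral_mult_right_zero zero by simp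
  qed
  have inner: "(LINT \<xi>|lborel. ?F x \<xi>) = c * (k x * of_real (exp (- s * (norm (x - y))\<^sup>2)))" for x
  proof -
    have "(LINT \<xi>|lborel. exp (- of_real \<epsilon> * of_real ((norm \<xi>)\<^sup>2) + \<i> * of_real ((y - x) \<bullet> \<xi>)))
        = c * exp (\<i>\<^sup>2 * of_real ((norm (y - x))\<^sup>2) / (4 * of_real \<epsilon>))"
      unfolding c_def by (rule integral_gaussian_linear) (use \<epsilon> in simp)
    also have "\<i>\<^sup>2 * of_real ((norm (y - x))\<^sup>2) / (4 * of_real \<epsilon>) = complex_of_real (- s * (norm (x - y))\<^sup>2)"
      using s by (simp add: \<epsilon>_def norm_minus_commute)
    finally show ?thesis by (simp only: integral_mult_right_zero exp_of_real mult.left_commute)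
  qed
  have "(LINT x|lborel. c * (k x * of_real (exp (- s * (norm (x - y))\<^sup>2)))) = 0"
    using fub unfolding inner0 inner by simp
  then show ?thesis using c0 by simp
qed

text \<open>Convolving u with Gaussians of width 1/n gives bounded functions that converge pointwise
  to a multiple of u by continuity. Against each of them k integrates to zero by
  \<open>integral_gaussian_convolution_eq_0\<close>. Integrability of u justifies Fubini, its
  boundedness justifies the limit.\<close>

lemma integral_mult_continuous_eq_0:
  fixes k :: "'a::euclidean_space \<Rightarrow> complex" and u :: "'a \<Rightarrow> real"
  assumes k: "integrable lborel k"
    and zero: "\<And>\<xi>. (LINT x|lborel. k x * exp (- \<i> * of_real (\<xi> \<bullet> x))) = 0"
    and cont: "continuous_on UNIV u" and u: "integrable lborel u" and bound: "\<And>x. \<bar>u x\<bar> \<le> 1"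
  shows "(LINT x|lborel. k x * of_real (u x)) = 0"
proof -
  have [measurable]: "k \<in> borel_measurable borel" "u \<in> borel_measurable borel" using k u by auto
  let ?g = "\<lambda>z::'a. exp (- 1 * (norm z)\<^sup>2)"
  have g: "integrable lborel ?g" by (rule integrable_gaussian_euclidean) simp
  define G where "G = (LINT z|lborel. ?g z)"
  \<comment> \<open>This shows that G is nonzero, so it can be divided out at the end.\<close>
  have G: "complex_of_real G = of_real (sqrt pi) ^ DIM('a)"
    using integral_gaussian_linear[of 1 0 "0::'a"] unfolding G_def
    by (subst integral_complex_of_real[symmetric]) (simp add: exp_of_real[symmetric])
  \<comment> \<open>The convolution after the substitution y = x + z/n: the Gaussian no longer
    depends on n and serves as majorant.\<close>
  define h where "h = (\<lambda>n x. LINT z|lborel. u (x + (1 / real n) *\<^sub>R z) * ?g z)"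
  have bd: "\<bar>u (x + c *\<^sub>R z) * ?g z\<bar> \<le> ?g z" for x z c
    using bound[of "x + c *\<^sub>R z"] by (simp add: abs_mult mult_left_le_one_le)
  have ig: "integrable lborel (\<lambda>z. u (x + c *\<^sub>R z) * ?g z)" for x c
    by (rule Bochner_Integration.integrable_bound[OF g]) (use bd in auto)
  have h0: "(LINT x|lborel. k x * of_real (h n x)) = 0" if n: "n > 0" for n
  proof -
    let ?F = "\<lambda>x y. k x * of_real (u y) * of_real (exp (- (real n)\<^sup>2 * (norm (x - y))\<^sup>2))"
    have "(LINT y|lborel. LINT x|lborel. ?F x y) = (LINT x|lborel. LINT y|lborel. ?F x y)"
    proof (rule Fubini_dominated)
      show "integrable lborel (\<lambda>x. norm (k x))" "integrable lborel (\<lambda>y. \<bar>u y\<bar>)" using k u by auto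
      show "norm (?F x y) \<le> norm (k x) * \<bar>u y\<bar>" for x y
        by (simp add: norm_mult mult_left_le)
    qed measurable
    moreover have "(LINT x|lborel. ?F x y) = 0" for y
    proof -
      have "(LINT x|lborel. ?F x y)
          = (LINT x|lborel. of_real (u y) * (k x * of_real (exp (- (real n)\<^sup>2 * (norm (x - y))\<^sup>2))))"
        by (simp add: ac_simps)
      also have "\<dots> = 0"
        unfolding integral_mult_right_zero
        using integral_gaussian_convolution_eq_0[OF k zero, of "(real n)\<^sup>2" y] n by simp
      finally show ?thesis .
    qed
    moreover have "(LINT y|lborel. ?F x y) = of_real ((1 / real n) ^ DIM('a)) * (k x * of_real (h n x))" for x
    proof -
      have "(LINT y|lborel. ?F x y) = \<bar>1 / real n\<bar> ^ DIM('a) *\<^sub>R (LINT z|lborel. ?F x (x + (1 / real n) *\<^sub>R z))"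
        by (rule integral_affine) (use n in auto)
      also have "(LINT z|lborel. ?F x (x + (1 / real n) *\<^sub>R z))
          = (LINT z|lborel. k x * of_real (u (x + (1 / real n) *\<^sub>R z) * ?g z))"
        using n by (intro Bochner_Integration.integral_cong) (auto simp: power_divide)
      also have "\<dots> = k x * of_real (h n x)"
        unfolding integral_mult_right_zero integral_complex_of_real h_def ..
      finally show ?thesis by (simp add: scaleR_conv_of_real)
    qed
    ultimately have "of_real ((1 / real n) ^ DIM('a)) * (LINT x|lborel. k x * of_real (h n x)) = 0"
      by simp
    then show ?thesis using n by simp
  qed
  have hle: "\<bar>h n x\<bar> \<le> G" for n x
  proof -
    have "\<bar>h n x\<bar> \<le> (LINT z|lborel. \<bar>u (x + (1 / real n) *\<^sub>R z) * ?g z\<bar>)"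
      unfolding h_def by (rule integral_abs_bound)
    also have "\<dots> \<le> G" unfolding G_def by (intro integral_mono integrable_abs ig g bd)
    finally show ?thesis .
  qed
  have hlim: "(\<lambda>n. h n x) \<longlonglongrightarrow> u x * G" for x
  proof -
    have "(\<lambda>n. h n x) \<longlonglongrightarrow> (LINT z|lborel. u x * ?g z)"
      unfolding h_def
    proof (rule integral_dominated_convergence[OF _ _ g])
      have "(\<lambda>n. u (x + (1 / real n) *\<^sub>R z)) \<longlonglongrightarrow> u (x + 0 *\<^sub>R z)" for z
        by (rule continuous_on_tendsto_compose[OF cont])
          (intro tendsto_intros lim_1_over_n | simp)+
      then show "AE z in lborel. (\<lambda>n. u (x + (1 / real n) *\<^sub>R z) * ?g z) \<longlonglongrightarrow> u x * ?g z"
        by (auto intro!: tendsto_intros)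
    qed (use bd in auto)
    then show ?thesis by (simp add: G_def)
  qed
  have "(\<lambda>n. LINT x|lborel. k x * of_real (h n x)) \<longlonglongrightarrow> (LINT x|lborel. k x * of_real (u x * G))"
  proof (rule integral_dominated_convergence)
    show "integrable lborel (\<lambda>x. norm (k x) * G)" using k by simp
    show "AE x in lborel. (\<lambda>n. k x * of_real (h n x)) \<longlonglongrightarrow> k x * of_real (u x * G)"
      using hlim by (intro AE_I2 tendsto_intros)
    show "AE x in lborel. norm (k x * of_real (h n x)) \<le> norm (k x) * G" for n
      using hle by (auto simp: norm_mult intro!: mult_left_mono)
    show "(\<lambda>x. k x * of_real (h n x)) \<in> borel_measurable lborel" for n
      unfolding h_def by measurable
  qed measurable
  moreover have "(\<lambda>n. LINT x|lborel. k x * of_real (h n x)) \<longlonglongrightarrow> 0"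
    by (rule tendsto_eventually) (use h0 in \<open>auto intro: eventually_sequentiallyI[of 1]\<close>)
  ultimately have "(LINT x|lborel. k x * of_real (u x * G)) = 0" by (rule LIMSEQ_unique)
  moreover have "(LINT x|lborel. k x * of_real (u x * G)) = (LINT x|lborel. (k x * of_real (u x)) * of_real G)"
    by (simp add: mult.assoc)
  ultimately show ?thesis using G by simp
qed

text \<open>Indicators of closed sets are pointwise limits of bounded continuous functions, so a
  weighted version of k has integral zero over each closed set. Closed sets are stable under
  intersection and generate the Borel sets, hence the same holds over all Borel sets.\<close>

lemma AE_eq_0_if_fourier_eq_0:
  fixes k :: "'a::euclidean_space \<Rightarrow> complex"
  assumes k: "integrable lborel k"
    and zero: "\<And>\<xi>. (LINT x|lborel. k x * exp (- \<i> * of_real (\<xi> \<bullet> x))) = 0"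
  shows "AE x in lborel. k x = 0"
proof -
  let ?g = "\<lambda>z::'a. exp (- 1 * (norm z)\<^sup>2)"
  have [measurable]: "k \<in> borel_measurable borel" using k by auto
  have g: "integrable lborel ?g" by (rule integrable_gaussian_euclidean) simp
  \<comment> \<open>The positive weight makes the cutoffs below integrable, even when the closed set
    has infinite measure, and leaves the zero set of k unchanged.\<close>
  define K where "K = (\<lambda>x. k x * of_real (?g x))"
  have K: "integrable lborel K"
    unfolding K_def by (rule Bochner_Integration.integrable_bound[OF k]) (auto simp: norm_mult mult_left_le)
  have closed0: "set_lebesgue_integral lborel C K = 0" if C: "closed C" for C
  \<comment> \<open>\<open>infdist\<close> to the empty set is 0 by convention, so the cutoffs would
    then be 1 everywhere.\<close>
  proof (cases "C = {}")
    case False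
    \<comment> \<open>Equal to 1 on C and to 0 at distance at least 1/n from C, for positive
      n.\<close>
    define v where "v = (\<lambda>n x. max 0 (1 - real n * infdist x C))"
    have vb: "0 \<le> v n x" "v n x \<le> 1" for n x by (auto simp: v_def infdist_nonneg)
    have vc: "continuous_on UNIV (v n)" for n unfolding v_def by (intro continuous_intros)
    have 0: "(LINT x|lborel. k x * of_real (v n x * ?g x)) = 0" for n
    proof (rule integral_mult_continuous_eq_0[OF k zero])
      show "continuous_on UNIV (\<lambda>x. v n x * ?g x)" by (intro continuous_intros vc)
      show "integrable lborel (\<lambda>x. v n x * ?g x)"
        by (rule Bochner_Integration.integrable_bound[OF g])
          (use vb in \<open>auto simp: abs_mult intro!: borel_measurable_continuous_onI continuous_intros vc mult_left_le_one_le\<close>)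
      show "\<bar>v n x * ?g x\<bar> \<le> 1" for x using vb[of n x] by (auto simp: abs_mult intro!: mult_le_one)
    qed
    have vlim: "(\<lambda>n. v n x) \<longlonglongrightarrow> indicator C x" for x
    proof (cases "x \<in> C")
      case True
      then show ?thesis by (simp add: v_def)
    next
      case nC: False
      then have d: "0 < infdist x C" using C False infdist_pos_not_in_closed by blast
      obtain N :: nat where N: "1 / infdist x C < real N" using reals_Archimedean2 by blast
      have "v n x = 0" if "n \<ge> N" for n
      proof -
        have "1 / infdist x C < real n" using N that by linarith
        then have "1 < real n * infdist x C" using d by (simp add: pos_divide_less_eq)
        then show ?thesis by (simp add: v_def)
      qed
      then show ?thesis using nC by (intro tendsto_eventually eventually_sequentiallyI[of N]) auto
    qed
    have "(\<lambda>n. LINT x|lborel. k x * of_real (v n x * ?g x)) \<longlonglongrightarrow> (LINT x|lborel. indicator C x *\<^sub>R K x)"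
    proof (rule integral_dominated_convergence)
      show "integrable lborel (\<lambda>x. norm (k x))" using k by simp
      show "AE x in lborel. (\<lambda>n. k x * of_real (v n x * ?g x)) \<longlonglongrightarrow> indicator C x *\<^sub>R K x"
      proof (rule AE_I2)
        fix x
        have "(\<lambda>n. k x * of_real (v n x * ?g x)) \<longlonglongrightarrow> k x * of_real (indicator C x * ?g x)"
          by (intro tendsto_intros vlim)
        then show "(\<lambda>n. k x * of_real (v n x * ?g x)) \<longlonglongrightarrow> indicator C x *\<^sub>R K x"
          by (simp add: K_def scaleR_conv_of_real ac_simps)
      qed
      show "AE x in lborel. norm (k x * of_real (v n x * ?g x)) \<le> norm (k x)" for n
        using vb[of n] by (intro AE_I2) (auto simp: norm_mult abs_mult intro!: mult_left_le mult_le_one)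
      show "(\<lambda>x. k x * of_real (v n x * ?g x)) \<in> borel_measurable lborel" for n
        using borel_measurable_continuous_onI[OF vc[of n]] by measurable
      show "(\<lambda>x. indicator C x *\<^sub>R K x) \<in> borel_measurable lborel"
        using C K by (auto intro!: borel_measurable_scaleR borel_measurable_indicator)
    qed
    then show ?thesis unfolding 0 set_lebesgue_integral_def using LIMSEQ_unique tendsto_const by blast
  qed (simp add: set_lebesgue_integral_def)
  have all: "set_lebesgue_integral lborel A K = 0" if "A \<in> sets lborel" for A
  proof -
    have "Int_stable {C :: 'a set. closed C}" "{C :: 'a set. closed C} \<subseteq> Pow UNIV"
        "A \<in> sigma_sets UNIV {C. closed C}"
      using that by (auto simp: Int_stable_def borel_eq_closed)
    then show ?thesis
    proof (induction rule: sigma_sets_induct_disjoint)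
      \<comment> \<open>The whole space is closed, so the integrals over A and its complement add up
        to zero.\<close>
      case (compl A)
      have A: "A \<in> sets lborel" using compl.hyps by (simp add: borel_eq_closed)
      have iA: "set_integrable lborel B K" if "B \<in> sets lborel" for B
        unfolding set_integrable_def using K that by (rule integrable_mult_indicator[rotated])
      have "set_lebesgue_integral lborel (A \<union> (UNIV - A)) K
          = set_lebesgue_integral lborel A K + set_lebesgue_integral lborel (UNIV - A) K"
        using A by (intro set_integral_Un iA) auto
      moreover have "set_lebesgue_integral lborel (A \<union> (UNIV - A)) K = 0"
        using closed0[of UNIV] by simp
      ultimately show ?case using compl.IH by simp
    next
      case (union A)
      have A: "A i \<in> sets lborel" for i using union.hyps by (auto simp: borel_eq_closed)
      have "set_lebesgue_integral lborel (\<Union>i. A i) K = (\<Sum>i. set_lebesgue_integral lborel (A i) K)"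
      proof (rule lebesgue_integral_countable_add[OF A])
        show "A i \<inter> A j = {}" if "i \<noteq> j" for i j using union.hyps that by (auto simp: disjoint_family_on_def)
        show "set_integrable lborel (\<Union>i. A i) K"
          unfolding set_integrable_def using A K by (intro integrable_mult_indicator) auto
      qed
      then show ?case using union.IH by simp
    qed (use closed0 in auto)
  qed
  have "AE x in lborel. K x = 0" by (rule sigma_finite_measure.density_zero[OF sigma_finite_lborel K all])
  then show ?thesis by eventually_elim (simp add: K_def)
qed

section \<open>Orbits of unitary groups on \<open>L\<^sup>2\<close>\<close>

lemma L2_measurable: "f \<in> L2 M \<Longrightarrow> f \<in> borel_measurable M"
  and L2_integrable: "f \<in> L2 M \<Longrightarrow> integrable M (\<lambda>x. (cmod (f x))\<^sup>2)"
  by (auto simp: L2_def)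

lemma L2_lincomb:
  assumes "f \<in> L2 M" "g \<in> L2 M"
  shows "(\<lambda>x. a * f x + b * g x) \<in> L2 M"
proof -
  note [measurable] = assms[THEN L2_measurable]
  have "integrable M (\<lambda>x. (cmod (a * f x + b * g x))\<^sup>2)"
  proof (rule Bochner_Integration.integrable_bound)
    show "integrable M (\<lambda>x. 2 * (cmod a)\<^sup>2 * (cmod (f x))\<^sup>2 + 2 * (cmod b)\<^sup>2 * (cmod (g x))\<^sup>2)"
      using assms[THEN L2_integrable] by simp
    have "(cmod (a * f x + b * g x))\<^sup>2 \<le> 2 * (cmod a)\<^sup>2 * (cmod (f x))\<^sup>2 + 2 * (cmod b)\<^sup>2 * (cmod (g x))\<^sup>2" for x
    proof -
      have "(cmod (a * f x + b * g x))\<^sup>2 \<le> (cmod a * cmod (f x) + cmod b * cmod (g x))\<^sup>2"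
        by (intro power_mono) (auto simp: norm_triangle_ineq norm_mult[symmetric])
      also have "\<dots> \<le> 2 * (cmod a * cmod (f x))\<^sup>2 + 2 * (cmod b * cmod (g x))\<^sup>2"
        using sum_squares_bound[of "cmod a * cmod (f x)" "cmod b * cmod (g x)"] by (simp add: power2_sum)
      finally show ?thesis by (simp add: power_mult_distrib)
    qed
    then show "AE x in M. norm ((cmod (a * f x + b * g x))\<^sup>2)
        \<le> norm (2 * (cmod a)\<^sup>2 * (cmod (f x))\<^sup>2 + 2 * (cmod b)\<^sup>2 * (cmod (g x))\<^sup>2)"
      by (intro AE_I2) (auto intro: order_trans[OF _ abs_ge_self])
  qed measurable
  then show ?thesis by (auto simp: L2_def)
qed

lemma L2_add: "f \<in> L2 M \<Longrightarrow> g \<in> L2 M \<Longrightarrow> (\<lambda>x. f x + g x) \<in> L2 M"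
  and L2_diff: "f \<in> L2 M \<Longrightarrow> g \<in> L2 M \<Longrightarrow> (\<lambda>x. f x - g x) \<in> L2 M"
  and L2_cmult: "f \<in> L2 M \<Longrightarrow> (\<lambda>x. a * f x) \<in> L2 M"
  using L2_lincomb[of f M g 1 1] L2_lincomb[of f M g 1 "-1"] L2_lincomb[of f M f a 0] by auto

lemma l2_norm_nonneg: "0 \<le> l2_norm M f"
  by (simp add: l2_norm_def)

lemma l2_norm_cmult: "l2_norm M (\<lambda>x. a * f x) = cmod a * l2_norm M f"
  by (simp add: l2_norm_def norm_mult power_mult_distrib real_sqrt_mult)

lemma l2_norm_cong_AE:
  assumes "f \<in> L2 M" "g \<in> L2 M" "AE x in M. f x = g x"
  shows "l2_norm M f = l2_norm M g"
proof -
  note [measurable] = assms(1,2)[THEN L2_measurable]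
  have "(LINT x|M. (cmod (f x))\<^sup>2) = (LINT x|M. (cmod (g x))\<^sup>2)"
    by (rule integral_cong_AE) (use assms(3) in auto)
  then show ?thesis by (simp add: l2_norm_def)
qed

lemma l2_norm_eq_0_iff:
  assumes "f \<in> L2 M"
  shows "l2_norm M f = 0 \<longleftrightarrow> (AE x in M. f x = 0)"
  using integral_nonneg_eq_0_iff_AE[OF L2_integrable[OF assms]] by (simp add: l2_norm_def)

text \<open>The Peter-Paul inequality with weights approaching the two norms avoids a separate
  treatment of functions of norm zero.\<close>

lemma l2_norm_triangle:
  assumes f: "f \<in> L2 M" and g: "g \<in> L2 M"
  shows "l2_norm M (\<lambda>x. f x + g x) \<le> l2_norm M f + l2_norm M g"
proof (rule field_le_epsilon)
  fix e :: real assume e: "0 < e"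
  note [measurable] = f[THEN L2_measurable] g[THEN L2_measurable]
  define a where "a = l2_norm M f + e / 2"
  define b where "b = l2_norm M g + e / 2"
  have ab: "0 < a" "0 < b" "l2_norm M f \<le> a" "l2_norm M g \<le> b"
    using e l2_norm_nonneg[of M f] l2_norm_nonneg[of M g] by (auto simp: a_def b_def)
  have F: "(LINT x|M. (cmod (f x))\<^sup>2) \<le> a\<^sup>2" "(LINT x|M. (cmod (g x))\<^sup>2) \<le> b\<^sup>2"
    using ab unfolding l2_norm_def by (auto simp: real_sqrt_le_iff real_le_lsqrt sqrt_le_D)
  have pw: "(cmod (f x + g x))\<^sup>2 \<le> (1 + b / a) * (cmod (f x))\<^sup>2 + (1 + a / b) * (cmod (g x))\<^sup>2" for x
  proof -
    have "0 \<le> (b * cmod (f x) - a * cmod (g x))\<^sup>2 / (a * b)" using ab by simp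
    also have "\<dots> = b / a * (cmod (f x))\<^sup>2 + a / b * (cmod (g x))\<^sup>2 - 2 * cmod (f x) * cmod (g x)"
      using ab by (simp add: power2_eq_square field_simps)
    finally have "(cmod (f x) + cmod (g x))\<^sup>2 \<le> (1 + b / a) * (cmod (f x))\<^sup>2 + (1 + a / b) * (cmod (g x))\<^sup>2"
      by (simp add: power2_sum algebra_simps)
    moreover have "(cmod (f x + g x))\<^sup>2 \<le> (cmod (f x) + cmod (g x))\<^sup>2"
      by (intro power_mono norm_triangle_ineq) auto
    ultimately show ?thesis by linarith
  qed
  have "(LINT x|M. (cmod (f x + g x))\<^sup>2)
      \<le> (LINT x|M. (1 + b / a) * (cmod (f x))\<^sup>2 + (1 + a / b) * (cmod (g x))\<^sup>2)"
    by (rule integral_mono) (use pw f g L2_add[OF f g] in \<open>auto simp: L2_def\<close>)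
  also have "\<dots> = (1 + b / a) * (LINT x|M. (cmod (f x))\<^sup>2) + (1 + a / b) * (LINT x|M. (cmod (g x))\<^sup>2)"
    using f g by (simp add: L2_def)
  also have "\<dots> \<le> (1 + b / a) * a\<^sup>2 + (1 + a / b) * b\<^sup>2"
    using F ab by (intro add_mono mult_left_mono) auto
  also have "\<dots> = (a + b)\<^sup>2" using ab by (simp add: power2_eq_square field_simps)
  finally have "l2_norm M (\<lambda>x. f x + g x) \<le> a + b"
    unfolding l2_norm_def using ab by (intro real_le_lsqrt) auto
  then show "l2_norm M (\<lambda>x. f x + g x) \<le> l2_norm M f + l2_norm M g + e"
    by (simp add: a_def b_def)
qed

lemma l2_inner_self: "l2_inner M f f = of_real ((l2_norm M f)\<^sup>2)"
proof -
  have "l2_inner M f f = (LINT x|M. of_real ((cmod (f x))\<^sup>2))"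
    by (simp add: l2_inner_def complex_norm_square[symmetric])
  then show ?thesis by (simp only: integral_complex_of_real) (simp add: l2_norm_def)
qed

lemma unitary_group_mem: "unitary_group M U \<Longrightarrow> f \<in> L2 M \<Longrightarrow> U t f \<in> L2 M"
  and unitary_group_inner:
    "unitary_group M U \<Longrightarrow> f \<in> L2 M \<Longrightarrow> g \<in> L2 M \<Longrightarrow> l2_inner M (U t f) (U t g) = l2_inner M f g"
  and unitary_group_zero: "unitary_group M U \<Longrightarrow> f \<in> L2 M \<Longrightarrow> AE x in M. U 0 f x = f x"
  and unitary_group_plus: "unitary_group M U \<Longrightarrow> f \<in> L2 M \<Longrightarrow> AE x in M. U (s + t) f x = U s (U t f) x"
  unfolding unitary_group_def by blast+

lemma unitary_group_diff:
  assumes "unitary_group M U" "f \<in> L2 M" "g \<in> L2 M"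
  shows "AE x in M. U t (\<lambda>y. f y - g y) x = U t f x - U t g x"
proof -
  have "AE x in M. U t (\<lambda>y. 1 * f y + (-1) * g y) x = 1 * U t f x + (-1) * U t g x"
    using assms unfolding unitary_group_def by blast
  then show ?thesis by simp
qed

lemma unitary_group_norm:
  assumes "unitary_group M U" "f \<in> L2 M"
  shows "l2_norm M (U t f) = l2_norm M f"
proof -
  have "complex_of_real ((l2_norm M (U t f))\<^sup>2) = of_real ((l2_norm M f)\<^sup>2)"
    using unitary_group_inner[OF assms(1,2,2)] by (simp only: l2_inner_self)
  then have "(l2_norm M (U t f))\<^sup>2 = (l2_norm M f)\<^sup>2" by (simp only: of_real_eq_iff)
  then show ?thesis by (rule power2_eq_imp_eq[OF _ l2_norm_nonneg l2_norm_nonneg])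
qed

text \<open>The distance between \<open>v s\<close> and \<open>U s (v 0)\<close> has derivative zero, because
  \<open>v (s + h)\<close> and \<open>U h (v s)\<close> differ by \<open>o(h)\<close> and \<open>U h\<close> is isometric.\<close>

lemma unitary_group_orbit:
  assumes U: "unitary_group M U"
    and v: "\<And>s. v s \<in> L2 M"
    and gen: "\<And>s. generator M U (v s) (v' s)"
    and der: "\<And>s. ((\<lambda>h. l2_norm M (\<lambda>x. (v (s + h) x - v s x) / of_real h - v' s x)) \<longlongrightarrow> 0) (at 0)"
  shows "AE x in M. U s (v 0) x = v s x"
proof -
  have v': "v' s \<in> L2 M" for s using gen by (simp add: generator_def)
  note UL = unitary_group_mem[OF U]
  define n where "n = (\<lambda>s. l2_norm M (\<lambda>x. v s x - U s (v 0) x))"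
  have "(n has_real_derivative 0) (at s)" for s
    unfolding DERIV_def
  proof (rule Lim_null_comparison)
    let ?P = "\<lambda>h x. (v (s + h) x - v s x) / of_real h - v' s x"
    let ?Q = "\<lambda>h x. (U h (v s) x - v s x) / of_real h - v' s x"
    have "((\<lambda>h. l2_norm M (?P h) + l2_norm M (?Q h)) \<longlongrightarrow> 0 + 0) (at 0)"
      by (intro tendsto_add der) (use gen in \<open>auto simp: generator_def\<close>)
    then show "((\<lambda>h. l2_norm M (?P h) + l2_norm M (?Q h)) \<longlongrightarrow> 0) (at 0)" by simp
    have "norm ((n (s + h) - n s) / h) \<le> l2_norm M (?P h) + l2_norm M (?Q h)" if h: "h \<noteq> 0" for h
    proof -
      have PQ: "?P h \<in> L2 M" "?Q h \<in> L2 M"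
        using L2_diff[OF L2_cmult[OF L2_diff[OF v[of "s + h"] v[of s]], of "1 / of_real h"] v'[of s]]
          L2_diff[OF L2_cmult[OF L2_diff[OF UL[OF v[of s], of h] v[of s]], of "1 / of_real h"] v'[of s]]
        by auto
      let ?f = "\<lambda>x. v (s + h) x - U (s + h) (v 0) x"
      let ?g = "\<lambda>x. U h (v s) x - U (s + h) (v 0) x"
      \<comment> \<open>This equals v (s + h) - U h (v s): in the difference of the two remainders
        the terms v s and h v' s cancel.\<close>
      let ?r = "\<lambda>x. of_real h * ?P h x + (- of_real h) * ?Q h x"
      have L: "?f \<in> L2 M" "?g \<in> L2 M" "?r \<in> L2 M"
        by (intro L2_diff L2_lincomb v UL PQ)+
      have eq: "?f x = ?g x + ?r x" "?g x = ?f x + (- 1) * ?r x" for x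
        using h by (simp_all add: field_simps)
      have "l2_norm M ?r \<le> \<bar>h\<bar> * l2_norm M (?P h) + \<bar>h\<bar> * l2_norm M (?Q h)"
        using l2_norm_triangle[OF L2_cmult[OF PQ(1)] L2_cmult[OF PQ(2)], of "of_real h" "- of_real h"]
        by (simp only: l2_norm_cmult) simp
      moreover have "l2_norm M ?f \<le> l2_norm M ?g + l2_norm M ?r"
        using l2_norm_triangle[OF L(2,3)] by (simp only: eq(1)[symmetric])
      moreover have "l2_norm M ?g \<le> l2_norm M ?f + l2_norm M ?r"
        using l2_norm_triangle[OF L(1) L2_cmult[OF L(3), of "-1"]]
        unfolding l2_norm_cmult[of M "-1"] by (simp only: eq(2)[symmetric]) simp
      \<comment> \<open>By the group law and linearity \<open>?g\<close> is U h applied to v s - U s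
        (v 0), and U h preserves the norm.\<close>
      moreover have "l2_norm M ?g = n s"
      proof -
        have "AE x in M. U (h + s) (v 0) x = U h (U s (v 0)) x"
          by (rule unitary_group_plus[OF U v])
        moreover have "AE x in M. U h (\<lambda>y. v s y - U s (v 0) y) x = U h (v s) x - U h (U s (v 0)) x"
          by (rule unitary_group_diff[OF U v UL[OF v]])
        ultimately have "AE x in M. ?g x = U h (\<lambda>y. v s y - U s (v 0) y) x"
          by eventually_elim (simp add: add.commute)
        then have "l2_norm M ?g = l2_norm M (U h (\<lambda>y. v s y - U s (v 0) y))"
          by (intro l2_norm_cong_AE L UL L2_diff v)
        also have "\<dots> = n s" unfolding n_def by (intro unitary_group_norm[OF U] L2_diff v UL)
        finally show ?thesis .
      qed
      moreover have "l2_norm M ?f = n (s + h)" by (simp add: n_def)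
      ultimately have "\<bar>n (s + h) - n s\<bar> \<le> \<bar>h\<bar> * (l2_norm M (?P h) + l2_norm M (?Q h))"
        by (simp only: distrib_left)
      then show ?thesis using h by (simp add: abs_divide pos_divide_le_eq mult.commute)
    qed
    then show "\<forall>\<^sub>F h in at 0. norm ((n (s + h) - n s) / h) \<le> l2_norm M (?P h) + l2_norm M (?Q h)"
      by (simp add: eventually_at_filter)
  qed
  then have "n s = n 0" by (intro DERIV_isconst_all) auto
  also have "n 0 = 0"
    unfolding n_def using unitary_group_zero[OF U v[of 0]]
    by (subst l2_norm_eq_0_iff) (auto intro!: L2_diff v UL)
  finally have "l2_norm M (\<lambda>x. v s x - U s (v 0) x) = 0" by (simp add: n_def)
  then have "AE x in M. v s x - U s (v 0) x = 0"
    by (subst (asm) l2_norm_eq_0_iff) (auto intro!: L2_diff v UL)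
  then show ?thesis by eventually_elim simp
qed

section \<open>The Ornstein-Uhlenbeck group on Hermite generating functions\<close>

definition gauss_weight :: "'a::euclidean_space \<Rightarrow> real" where
  "gauss_weight x = (2 * pi) powr (- real DIM('a) / 2) * exp (- (norm x)\<^sup>2 / 2)"

lemma gauss_measure_eq_density: "gauss_measure = density lborel (\<lambda>x. ennreal (gauss_weight x))"
  by (simp add: gauss_measure_def gauss_weight_def)

lemma gauss_weight_pos: "0 < gauss_weight x"
  by (simp add: gauss_weight_def)

lemma gauss_weight_measurable [measurable]: "gauss_weight \<in> borel_measurable borel"
  unfolding gauss_weight_def by measurable

lemma borel_measurable_cnj [measurable]: "cnj \<in> borel_measurable borel"
  by (intro borel_measurable_continuous_onI continuous_intros)

lemma sets_gauss_measure [measurable_cong, simp]: "sets gauss_measure = sets borel"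
  by (simp add: gauss_measure_def)

lemma space_gauss_measure [simp]: "space gauss_measure = UNIV"
  by (simp add: gauss_measure_def)

lemma borel_measurable_gauss_measure [simp]: "borel_measurable gauss_measure = borel_measurable borel"
  by (intro measurable_cong_sets) auto

lemma AE_gauss_measure: "(AE x in gauss_measure. P x) \<longleftrightarrow> (AE x in lborel. P x)"
  unfolding gauss_measure_eq_density using gauss_weight_pos by (subst AE_density) auto

lemma
  fixes f :: "'a::euclidean_space \<Rightarrow> 'b::{banach, second_countable_topology}"
  assumes "f \<in> borel_measurable borel"
  shows integrable_gauss_measure:
      "integrable gauss_measure f \<longleftrightarrow> integrable lborel (\<lambda>x. gauss_weight x *\<^sub>R f x)"
    and integral_gauss_measure:
      "(LINT x|gauss_measure. f x) = (LINT x|lborel. gauss_weight x *\<^sub>R f x)"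
proof -
  have "AE x in lborel. 0 \<le> gauss_weight (x :: 'a)" by (intro AE_I2 less_imp_le gauss_weight_pos)
  then show "integrable gauss_measure f \<longleftrightarrow> integrable lborel (\<lambda>x. gauss_weight x *\<^sub>R f x)"
    and "(LINT x|gauss_measure. f x) = (LINT x|lborel. gauss_weight x *\<^sub>R f x)"
    unfolding gauss_measure_eq_density using assms by (intro integrable_density integral_density; simp)+
qed

lemma integrable_gauss_measure_exp_growth:
  "integrable gauss_measure (\<lambda>x::'a::euclidean_space. exp (B * norm x))"
proof -
  obtain C where C: "\<And>r. (1 + r\<^sup>2) * exp (B * \<bar>r\<bar> - 1 / 2 * r\<^sup>2) \<le> C * exp (- (1 / 2 / 2) * r\<^sup>2)"
    using gaussian_absorbs[of "1 / 2" B] by auto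
  let ?c = "(2 * pi) powr (- real DIM('a) / 2)"
  have "integrable lborel (\<lambda>x::'a. gauss_weight x *\<^sub>R exp (B * norm x))"
  proof (rule integrable_gaussian_bound[of _ "1 / 2 / 2"])
    fix x :: 'a
    have "norm (gauss_weight x *\<^sub>R exp (B * norm x)) = ?c * (1 * exp (B * \<bar>norm x\<bar> - 1 / 2 * (norm x)\<^sup>2))"
      by (simp add: gauss_weight_def flip: exp_add)
    also have "\<dots> \<le> ?c * ((1 + (norm x)\<^sup>2) * exp (B * \<bar>norm x\<bar> - 1 / 2 * (norm x)\<^sup>2))"
      by (intro mult_left_mono mult_right_mono) auto
    also have "\<dots> \<le> ?c * (C * exp (- (1 / 2 / 2) * (norm x)\<^sup>2))"
      by (intro mult_left_mono C) auto
    finally show "norm (gauss_weight x *\<^sub>R exp (B * norm x)) \<le> (?c * C) * exp (- (1 / 2 / 2) * (norm x)\<^sup>2)"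
      by simp
  qed auto
  then show ?thesis by (subst integrable_gauss_measure) auto
qed

lemma L2_gauss_measureI:
  fixes f :: "'a::euclidean_space \<Rightarrow> complex"
  assumes f: "f \<in> borel_measurable borel" and le: "\<And>x. cmod (f x) \<le> K * exp (B * norm x)"
  shows "f \<in> L2 gauss_measure"
proof -
  note [measurable] = f
  have "integrable gauss_measure (\<lambda>x. (cmod (f x))\<^sup>2)"
  proof (rule Bochner_Integration.integrable_bound)
    show "integrable gauss_measure (\<lambda>x::'a. K\<^sup>2 * exp ((2 * B) * norm x))"
      by (intro integrable_mult_right integrable_gauss_measure_exp_growth)
    have "(cmod (f x))\<^sup>2 \<le> K\<^sup>2 * exp ((2 * B) * norm x)" for x
    proof -
      have "(cmod (f x))\<^sup>2 \<le> (K * exp (B * norm x))\<^sup>2" by (intro power_mono le) auto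
      also have "\<dots> = K\<^sup>2 * exp ((2 * B) * norm x)"
        by (simp add: power_mult_distrib mult.assoc flip: exp_double)
      finally show ?thesis .
    qed
    then show "AE x in gauss_measure. norm ((cmod (f x))\<^sup>2) \<le> norm (K\<^sup>2 * exp ((2 * B) * norm x))"
      by (intro AE_I2) (auto intro: order_trans[OF _ abs_ge_self])
  qed measurable
  then show ?thesis using f by (simp add: L2_def)
qed

text \<open>The generating function of the Hermite polynomials, with \<open>\<xi>\<close> times \<open>c\<close> as parameter;
  \<open>hermite_exp_OU\<close> is its image under \<open>OU_expr\<close>.\<close>

definition hermite_exp :: "'a::euclidean_space \<Rightarrow> complex \<Rightarrow> 'a \<Rightarrow> complex" where
  "hermite_exp \<xi> c x = exp (c * of_real (\<xi> \<bullet> x) - c\<^sup>2 * of_real ((norm \<xi>)\<^sup>2) / 2)"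

definition hermite_exp_OU :: "'a::euclidean_space \<Rightarrow> complex \<Rightarrow> 'a \<Rightarrow> complex" where
  "hermite_exp_OU \<xi> c x = (c\<^sup>2 * of_real ((norm \<xi>)\<^sup>2) - c * of_real (\<xi> \<bullet> x)) * hermite_exp \<xi> c x"

lemma hermite_exp_measurable [measurable]: "hermite_exp \<xi> c \<in> borel_measurable borel"
  and hermite_exp_OU_measurable [measurable]: "hermite_exp_OU \<xi> c \<in> borel_measurable borel"
  unfolding hermite_exp_OU_def hermite_exp_def by measurable

text \<open>The bounds depend on c only through |c| |\<xi>|. They are therefore the same along the
  whole rotation c e^(-is) and serve as majorants uniform in time.\<close>

lemma hermite_exp_bound:
  fixes \<xi> x :: "'a::euclidean_space"
  assumes "cmod c * norm \<xi> = B"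
  shows "cmod (hermite_exp \<xi> c x) \<le> exp (B\<^sup>2) * exp (B * norm x)"
    and "cmod (hermite_exp_OU \<xi> c x) \<le> (B\<^sup>2 + B) * exp (B\<^sup>2) * exp ((B + 1) * norm x)"
proof -
  have B: "0 \<le> B" using assms by (metis norm_ge_zero mult_nonneg_nonneg)
  have lin: "cmod (c * of_real (\<xi> \<bullet> x)) \<le> B * norm x"
  proof -
    have "cmod (c * of_real (\<xi> \<bullet> x)) \<le> cmod c * (norm \<xi> * norm x)"
      by (simp add: norm_mult Cauchy_Schwarz_ineq2 mult_left_mono)
    then show ?thesis by (simp add: assms[symmetric] mult.assoc)
  qed
  have quad: "cmod (c\<^sup>2 * of_real ((norm \<xi>)\<^sup>2)) = B\<^sup>2"
    by (simp add: norm_mult norm_power assms[symmetric] power_mult_distrib)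
  have "cmod (c * of_real (\<xi> \<bullet> x) - c\<^sup>2 * of_real ((norm \<xi>)\<^sup>2) / 2) \<le> B * norm x + B\<^sup>2 / 2"
    using norm_triangle_ineq4[of "c * of_real (\<xi> \<bullet> x)" "c\<^sup>2 * of_real ((norm \<xi>)\<^sup>2) / 2"] lin quad
    by (simp add: norm_divide)
  also have "\<dots> \<le> B * norm x + B\<^sup>2" using zero_le_power2[of B] by linarith
  finally have "Re (c * of_real (\<xi> \<bullet> x) - c\<^sup>2 * of_real ((norm \<xi>)\<^sup>2) / 2) \<le> B\<^sup>2 + B * norm x"
    using complex_Re_le_cmod order_trans by (metis add.commute)
  then show 1: "cmod (hermite_exp \<xi> c x) \<le> exp (B\<^sup>2) * exp (B * norm x)"
    unfolding hermite_exp_def norm_exp_eq_Re exp_add[symmetric] exp_le_cancel_iff .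
  have "cmod (c\<^sup>2 * of_real ((norm \<xi>)\<^sup>2) - c * of_real (\<xi> \<bullet> x)) \<le> B\<^sup>2 + B * norm x"
    using norm_triangle_ineq4[of "c\<^sup>2 * of_real ((norm \<xi>)\<^sup>2)" "c * of_real (\<xi> \<bullet> x)"] lin quad by simp
  also have "\<dots> \<le> B\<^sup>2 * exp (norm x) + B * exp (norm x)"
    using B exp_ge_add_one_self[of "norm x"] order_trans[of "norm x" "1 + norm x" "exp (norm x)"]
    by (intro add_mono mult_left_mono mult_left_le[of 1, simplified] ) (auto simp: mult_le_cancel_left1)
  also have "\<dots> = (B\<^sup>2 + B) * exp (norm x)" by (simp add: algebra_simps)
  finally have "cmod (hermite_exp_OU \<xi> c x) \<le> ((B\<^sup>2 + B) * exp (norm x)) * (exp (B\<^sup>2) * exp (B * norm x))"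
    unfolding hermite_exp_OU_def norm_mult using 1 B by (intro mult_mono) auto
  also have "\<dots> = (B\<^sup>2 + B) * exp (B\<^sup>2) * exp ((B + 1) * norm x)"
    by (simp add: algebra_simps exp_add)
  finally show "cmod (hermite_exp_OU \<xi> c x) \<le> (B\<^sup>2 + B) * exp (B\<^sup>2) * exp ((B + 1) * norm x)" .
qed

lemma hermite_exp_L2: "hermite_exp \<xi> c \<in> L2 gauss_measure"
  and hermite_exp_OU_L2: "hermite_exp_OU \<xi> c \<in> L2 gauss_measure"
  by (rule L2_gauss_measureI[OF hermite_exp_measurable hermite_exp_bound(1)[OF refl]])
    (rule L2_gauss_measureI[OF hermite_exp_OU_measurable hermite_exp_bound(2)[OF refl]])

lemma has_vector_derivative_hermite_exp_direction:
  "((\<lambda>s. hermite_exp \<xi> c (x + s *\<^sub>R b)) has_vector_derivative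
    c * of_real (\<xi> \<bullet> b) * hermite_exp \<xi> c x) (at 0)"
proof -
  have "((\<lambda>z. exp (c * (of_real (\<xi> \<bullet> x) + z * of_real (\<xi> \<bullet> b)) - c\<^sup>2 * of_real ((norm \<xi>)\<^sup>2) / 2))
      has_field_derivative c * of_real (\<xi> \<bullet> b) * hermite_exp \<xi> c x) (at (of_real 0))"
    unfolding hermite_exp_def by (auto intro!: derivative_eq_intros)
  from has_vector_derivative_real_field[OF this] show ?thesis
    unfolding hermite_exp_def by (simp add: inner_add_right)
qed

text \<open>\<open>hermite_exp_OU\<close> is -c d/dc of \<open>hermite_exp\<close>, and the
  derivative of c e^(-is) in s is -i times itself; the chain rule gives the factor i of the
  Schroedinger equation.\<close>

lemma has_vector_derivative_hermite_exp_rotation: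
  "((\<lambda>s. hermite_exp \<xi> (c * exp (- \<i> * of_real s)) x) has_vector_derivative
    \<i> * hermite_exp_OU \<xi> (c * exp (- \<i> * of_real s)) x) (at s)"
proof -
  have "((\<lambda>z. exp ((c * exp (- \<i> * z)) * of_real (\<xi> \<bullet> x) - (c * exp (- \<i> * z))\<^sup>2 * of_real ((norm \<xi>)\<^sup>2) / 2))
      has_field_derivative \<i> * hermite_exp_OU \<xi> (c * exp (- \<i> * of_real s)) x) (at (of_real s))"
    unfolding hermite_exp_OU_def hermite_exp_def
    by (auto intro!: derivative_eq_intros simp: power2_eq_square algebra_simps)
  from has_vector_derivative_real_field[OF this] show ?thesis
    unfolding hermite_exp_def by simp
qed

text \<open>Pointwise convergence is the derivative in s. The mean value inequality bounds the error
  by a function of exponential growth independent of h, whose square is integrable for the Gaussian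
  measure, so dominated convergence lifts the limit to L2.\<close>

lemma hermite_exp_rotation_L2_derivative:
  fixes \<xi> :: "'a::euclidean_space" and c :: complex
  defines "v \<equiv> \<lambda>s::real. hermite_exp \<xi> (c * exp (- \<i> * of_real s))"
    and "v' \<equiv> \<lambda>s::real. \<lambda>x. \<i> * hermite_exp_OU \<xi> (c * exp (- \<i> * of_real s)) x"
  shows "((\<lambda>h. l2_norm gauss_measure (\<lambda>x. (v (s + h) x - v s x) / of_real h - v' s x)) \<longlongrightarrow> 0) (at 0)"
proof -
  define B where "B = cmod c * norm \<xi>"
  define K where "K = (B\<^sup>2 + B) * exp (B\<^sup>2)"
  have [measurable]: "v s \<in> borel_measurable borel" "v' s \<in> borel_measurable borel" for s
    unfolding v_def v'_def by measurable
  have b: "cmod (v' s x) \<le> K * exp ((B + 1) * norm x)" for s x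
    unfolding v'_def K_def by (simp add: norm_mult) (rule hermite_exp_bound, simp add: norm_mult B_def)
  have d: "((\<lambda>s. v s x) has_vector_derivative v' s x) (at s)" for s x
    unfolding v_def v'_def by (rule has_vector_derivative_hermite_exp_rotation)
  let ?Q = "\<lambda>h x. (v (s + h) x - v s x) / of_real h - v' s x"
  have Q: "cmod (?Q h x) \<le> 2 * K * exp ((B + 1) * norm x)" if h: "h \<noteq> 0" for h x
  proof -
    have "cmod (v (s + h) x - v s x) \<le> K * exp ((B + 1) * norm x) * \<bar>h\<bar>"
      by (rule norm_increment_le[where r = "\<bar>h\<bar> + 1", OF d b]) auto
    then have "cmod ((v (s + h) x - v s x) / of_real h) \<le> K * exp ((B + 1) * norm x)"
      using h by (simp add: norm_divide pos_divide_le_eq)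
    then show ?thesis using norm_triangle_ineq4[of "(v (s + h) x - v s x) / of_real h" "v' s x"] b[of s x]
      by linarith
  qed
  have "((\<lambda>h. LINT x|gauss_measure. (cmod (?Q h x))\<^sup>2) \<longlongrightarrow> (LINT x::'a|gauss_measure. 0 :: real)) (at 0)"
  proof (rule integral_dominated_convergence_at)
    show "integrable gauss_measure (\<lambda>x::'a. (2 * K)\<^sup>2 * exp ((2 * (B + 1)) * norm x))"
      by (intro integrable_mult_right integrable_gauss_measure_exp_growth)
    have "norm ((cmod (?Q h x))\<^sup>2) \<le> (2 * K)\<^sup>2 * exp ((2 * (B + 1)) * norm x)" if "h \<noteq> 0" for h x
    proof -
      have "(cmod (?Q h x))\<^sup>2 \<le> (2 * K * exp ((B + 1) * norm x))\<^sup>2" by (intro power_mono Q that) auto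
      also have "\<dots> = (2 * K)\<^sup>2 * exp ((2 * (B + 1)) * norm x)"
        by (simp add: power_mult_distrib mult.assoc flip: exp_double)
      finally show ?thesis by simp
    qed
    moreover have "(\<lambda>x. (cmod (?Q h x))\<^sup>2) \<in> borel_measurable gauss_measure" for h by measurable
    ultimately show "\<forall>\<^sub>F h in at 0. (\<lambda>x. (cmod (?Q h x))\<^sup>2) \<in> borel_measurable gauss_measure \<and>
        (\<forall>x. norm ((cmod (?Q h x))\<^sup>2) \<le> (2 * K)\<^sup>2 * exp ((2 * (B + 1)) * norm x))"
      unfolding eventually_at_filter by (intro always_eventually) blast
    have "((\<lambda>h. (cmod (?Q h x))\<^sup>2) \<longlongrightarrow> (cmod (v' s x - v' s x))\<^sup>2) (at 0)" for x
      using d[of x s] unfolding has_vector_derivative_iff_quotient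
      by (intro tendsto_intros) (simp add: scaleR_conv_of_real divide_inverse mult.commute)
    then show "((\<lambda>h. (cmod (?Q h x))\<^sup>2) \<longlongrightarrow> 0) (at 0)" for x by simp
  qed auto
  then have "((\<lambda>h. sqrt (LINT x|gauss_measure. (cmod (?Q h x))\<^sup>2)) \<longlongrightarrow> sqrt 0) (at 0)"
    by (intro tendsto_real_sqrt) simp
  then show ?thesis by (simp add: l2_norm_def)
qed

section \<open>Green's formula and membership in the domain of the operator\<close>

lemma partials_eq_0_outside:
  assumes "open S" "\<And>x. x \<in> S \<Longrightarrow> f x = 0" "x \<in> S"
  shows "partials bs f x = 0"
  using assms(3)
proof (induction bs arbitrary: x)
  case (Cons b bs)
  have "(partials bs f has_derivative (\<lambda>_. 0)) (at x)"
    by (rule has_derivative_transform_within_open[OF has_derivative_const assms(1) Cons.prems, of 0])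
      (use Cons.IH in auto)
  then show ?case by (simp add: frechet_derivative_at[symmetric])
qed (use assms(2) in auto)

lemma has_vector_derivative_frechet_direction:
  fixes f :: "'a::euclidean_space \<Rightarrow> complex"
  assumes "f differentiable (at x)"
  shows "((\<lambda>s. f (x + s *\<^sub>R b)) has_vector_derivative frechet_derivative f (at x) b) (at 0)"
proof -
  have f: "(f has_derivative frechet_derivative f (at x)) (at (x + 0 *\<^sub>R b))"
    using assms by (simp add: frechet_derivative_works)
  have "((\<lambda>s. x + s *\<^sub>R b) has_derivative (\<lambda>h. h *\<^sub>R b)) (at (0::real))"
    by (auto intro!: derivative_eq_intros)
  from has_derivative_compose[OF this f] show ?thesis
    unfolding has_vector_derivative_def
    using linear_frechet_derivative[OF assms] by (simp add: linear_cmul)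
qed

text \<open>The maximum of |f(x)| e^(|x|^2) on S provides C. This casts compact support as the
  Gaussian decay on which the integration lemmas are built.\<close>

lemma compact_support_gaussian_bound:
  fixes f :: "'a::euclidean_space \<Rightarrow> complex"
  assumes "continuous_on UNIV f" "compact S" "\<And>x. x \<notin> S \<Longrightarrow> f x = 0"
  shows "\<exists>C. \<forall>x. norm (f x) \<le> C * exp (- 1 * (norm x)\<^sup>2)"
proof -
  have "compact ((\<lambda>x. f x * of_real (exp ((norm x)\<^sup>2))) ` S)"
    by (intro compact_continuous_image continuous_intros continuous_on_subset[OF assms(1)] assms(2)) auto
  then obtain C where "\<forall>y \<in> (\<lambda>x. f x * of_real (exp ((norm x)\<^sup>2))) ` S. norm y \<le> C" and C0: "0 < C"
    using compact_imp_bounded bounded_pos by metis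
  then have C: "norm (f x) * exp ((norm x)\<^sup>2) \<le> C" if "x \<in> S" for x
    using that by (simp add: norm_mult)
  have "norm (f x) \<le> C * exp (- 1 * (norm x)\<^sup>2)" for x
    using C[of x] C0 assms(3)[of x] by (cases "x \<in> S") (auto simp: exp_minus field_simps)
  then show ?thesis by blast
qed

lemma smooth_imp_continuous_partials:
  assumes "smooth f" "bs \<in> lists Basis"
  shows "continuous_on UNIV (partials bs f)"
  using assms unfolding smooth_def
  by (intro continuous_at_imp_continuous_on ballI differentiable_imp_continuous_within) auto

lemma test_function_partials_eq_0:
  assumes "test_function \<eta>" "x \<notin> closure {x. \<eta> x \<noteq> 0}"
  shows "partials bs \<eta> x = 0"
proof (rule partials_eq_0_outside)
  show "open (- closure {x. \<eta> x \<noteq> 0})" by (intro open_Compl closed_closure)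
  show "\<eta> x = 0" if "x \<in> - closure {x. \<eta> x \<noteq> 0}" for x
    using that closure_subset[of "{x. \<eta> x \<noteq> 0}"] by auto
qed (use assms(2) in simp)

text \<open>Green's formula: the integrand below is the derivative along \<open>b\<close> of
  \<open>e\<^sup>-\<^sup>|\<^sup>x\<^sup>|\<^sup>2\<^sup>/\<^sup>2 (H \<cdot> \<partial>\<^sub>b cnj \<eta> - cnj \<eta> \<cdot> \<partial>\<^sub>b H)\<close> for \<open>H = hermite_exp \<xi> c\<close>.\<close>

lemma hermite_exp_green_direction:
  fixes \<eta> :: "'a::euclidean_space \<Rightarrow> complex" and \<xi> :: 'a and c :: complex
  assumes \<eta>: "test_function \<eta>" and b: "b \<in> Basis"
  defines "I \<equiv> \<lambda>x. of_real (exp (- (norm x)\<^sup>2 / 2)) * (hermite_exp \<xi> c x * cnj (partials [b, b] \<eta> x)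
      - of_real (x \<bullet> b) * hermite_exp \<xi> c x * cnj (partials [b] \<eta> x)
      - cnj (\<eta> x) * ((c * of_real (\<xi> \<bullet> b))\<^sup>2 - of_real (x \<bullet> b) * (c * of_real (\<xi> \<bullet> b))) * hermite_exp \<xi> c x)"
  shows "integrable lborel I" and "(LINT x|lborel. I x) = 0"
proof -
  define S where "S = closure {x. \<eta> x \<noteq> 0}"
  have S: "compact S" using \<eta> by (simp add: test_function_def S_def)
  have out: "partials bs \<eta> x = 0" if "x \<notin> S" for bs x
    using test_function_partials_eq_0[OF \<eta>] that by (simp add: S_def)
  have diff: "partials bs \<eta> differentiable (at x)" if "set bs \<subseteq> {b}" for bs x
    using \<eta> b that by (auto simp: test_function_def smooth_def lists_eq_set)
  have cont: "continuous_on UNIV (partials bs \<eta>)" if "set bs \<subseteq> {b}" for bs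
    using \<eta> b that by (intro smooth_imp_continuous_partials) (auto simp: test_function_def lists_eq_set)
  have c0: "continuous_on UNIV \<eta>" and c1: "continuous_on UNIV (partials [b] \<eta>)"
    and c2: "continuous_on UNIV (partials [b, b] \<eta>)"
    using cont[of "[]"] cont[of "[b]"] cont[of "[b, b]"] by auto
  have cH: "continuous_on UNIV (hermite_exp \<xi> c)"
    unfolding hermite_exp_def by (intro continuous_intros) auto
  define w where "w = (\<lambda>x::'a. complex_of_real (exp (- (norm x)\<^sup>2 / 2)))"
  define F where "F = (\<lambda>x. w x * (hermite_exp \<xi> c x * cnj (partials [b] \<eta> x)
      - cnj (\<eta> x) * (c * of_real (\<xi> \<bullet> b) * hermite_exp \<xi> c x)))"
  have cF: "continuous_on UNIV F"
    unfolding F_def w_def by (intro continuous_intros c0 c1 cH) auto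
  have cI: "continuous_on UNIV I"
    unfolding I_def by (intro continuous_intros c0 c1 c2 cH) auto
  have "F x = 0" "I x = 0" if "x \<notin> S" for x
    using out[OF that, of "[]"] out[OF that, of "[b]"] out[OF that, of "[b, b]"]
    by (auto simp: F_def I_def simp del: partials.simps(2))
  then obtain C C' where C: "\<And>x. norm (F x) \<le> C * exp (- 1 * (norm x)\<^sup>2)"
      and C': "\<And>x. norm (I x) \<le> C' * exp (- 1 * (norm x)\<^sup>2)"
    using compact_support_gaussian_bound[OF cF S] compact_support_gaussian_bound[OF cI S] by metis
  have mI: "I \<in> borel_measurable borel" using cI by (rule borel_measurable_continuous_onI)
  show "integrable lborel I" by (rule integrable_gaussian_bound[OF mI zero_less_one C'])
  have iF: "integrable lborel F"
    by (rule integrable_gaussian_bound[OF borel_measurable_continuous_onI[OF cF] zero_less_one C])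
  have der: "((\<lambda>s. F (x + s *\<^sub>R b)) has_vector_derivative I x) (at 0)" for x
  proof -
    have dw: "((\<lambda>s. w (x + s *\<^sub>R b)) has_vector_derivative of_real (- (x \<bullet> b)) * w x) (at 0)"
    proof -
      have "((\<lambda>s. exp (- ((norm x)\<^sup>2 + 2 * s * (x \<bullet> b) + s\<^sup>2) / 2)) has_field_derivative
          - (x \<bullet> b) * exp (- (norm x)\<^sup>2 / 2)) (at 0)"
        by (auto intro!: derivative_eq_intros)
      moreover have "(norm (x + s *\<^sub>R b))\<^sup>2 = (norm x)\<^sup>2 + 2 * s * (x \<bullet> b) + s\<^sup>2" for s
        using b unfolding power2_norm_eq_inner
        by (simp add: inner_add_left inner_add_right inner_commute[of b x] power2_eq_square algebra_simps)
      ultimately have "((\<lambda>s. exp (- (norm (x + s *\<^sub>R b))\<^sup>2 / 2)) has_field_derivative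
          - (x \<bullet> b) * exp (- (norm x)\<^sup>2 / 2)) (at 0)" by simp
      from has_vector_derivative_of_real[OF this] show ?thesis unfolding w_def by simp
    qed
    have dp: "((\<lambda>s. cnj (partials bs \<eta> (x + s *\<^sub>R b))) has_vector_derivative cnj (partials (b # bs) \<eta> x)) (at 0)"
      if "set bs \<subseteq> {b}" for bs
      using bounded_linear.has_vector_derivative[OF bounded_linear_cnj
          has_vector_derivative_frechet_direction[OF diff[OF that], of x b]] by simp
    note dH = has_vector_derivative_hermite_exp_direction[of \<xi> c x b]
    have d1: "((\<lambda>s. cnj (partials [b] \<eta> (x + s *\<^sub>R b))) has_vector_derivative cnj (partials [b, b] \<eta> x)) (at 0)"
      using dp[of "[b]"] by simp
    have d0: "((\<lambda>s. cnj (\<eta> (x + s *\<^sub>R b))) has_vector_derivative cnj (partials [b] \<eta> x)) (at 0)"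
      using dp[of "[]"] by simp
    \<comment> \<open>In the product rule the two mixed terms, with one derivative on each of H and
      the conjugate of \<eta>, cancel.\<close>
    show ?thesis
      unfolding F_def
      by (rule has_vector_derivative_eq_rhs[OF has_vector_derivative_mult[OF dw
            has_vector_derivative_diff[OF has_vector_derivative_mult[OF dH d1]
              has_vector_derivative_mult[OF d0 has_vector_derivative_mult_right[OF dH]]]]])
        (simp add: I_def w_def power2_eq_square algebra_simps del: partials.simps)
  qed
  show "(LINT x|lborel. I x) = 0"
    by (rule integral_directional_derivative_gaussian[where F = F and b = b, OF iF der mI zero_less_one C'])
qed

text \<open>The domain is defined by duality with test functions, so the operator has to be moved
  from \<eta> to \<open>hermite_exp\<close>. The two integrands differ by the normalising constant
  times the sum over the basis of the Green integrands, each of integral zero.\<close>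

lemma hermite_exp_OU_operator: "OU_operator (hermite_exp \<xi> c) (hermite_exp_OU \<xi> c)"
  unfolding OU_operator_def
proof (intro conjI allI impI hermite_exp_L2 hermite_exp_OU_L2)
  fix \<eta> :: "'a \<Rightarrow> complex" assume \<eta>: "test_function \<eta>"
  let ?H = "hermite_exp \<xi> c" and ?\<kappa> = "complex_of_real ((2 * pi) powr (- real DIM('a) / 2))"
  define I where "I = (\<lambda>b x. complex_of_real (exp (- (norm x)\<^sup>2 / 2)) * (?H x * cnj (partials [b, b] \<eta> x)
      - of_real (x \<bullet> b) * ?H x * cnj (partials [b] \<eta> x)
      - cnj (\<eta> x) * ((c * of_real (\<xi> \<bullet> b))\<^sup>2 - of_real (x \<bullet> b) * (c * of_real (\<xi> \<bullet> b))) * ?H x))"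
  have green: "integrable lborel (I b)" "(LINT x|lborel. I b x) = 0" if "b \<in> Basis" for b
    unfolding I_def by (rule hermite_exp_green_direction[OF \<eta> that])+
  have sm: "smooth \<eta>" and S: "compact (closure {x. \<eta> x \<noteq> 0})"
    using \<eta> by (auto simp: test_function_def)
  have cp: "continuous_on UNIV (partials bs \<eta>)" if "bs \<in> lists Basis" for bs
    by (rule smooth_imp_continuous_partials[OF sm that])
  have c0: "continuous_on UNIV \<eta>" using cp[of "[]"] by simp
  have cOU: "continuous_on UNIV (OU_expr \<eta>)"
    unfolding OU_expr_def[abs_def] by (intro continuous_intros cp) (auto simp del: partials.simps)
  have [measurable]: "\<eta> \<in> borel_measurable borel" "OU_expr \<eta> \<in> borel_measurable borel"
    using c0 cOU by (auto intro: borel_measurable_continuous_onI)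
  let ?A = "\<lambda>x. gauss_weight x *\<^sub>R (hermite_exp_OU \<xi> c x * cnj (\<eta> x))"
  let ?B = "\<lambda>x. gauss_weight x *\<^sub>R (?H x * cnj (OU_expr \<eta> x))"
  have cA: "continuous_on UNIV ?A"
    unfolding gauss_weight_def[abs_def] hermite_exp_OU_def hermite_exp_def
    by (intro continuous_intros c0) auto
  have "?A x = 0" if "x \<notin> closure {x. \<eta> x \<noteq> 0}" for x
    using test_function_partials_eq_0[OF \<eta> that, of "[]"] by simp
  then obtain C where "\<And>x. norm (?A x) \<le> C * exp (- 1 * (norm x)\<^sup>2)"
    using compact_support_gaussian_bound[OF cA S] by blast
  then have iA: "integrable lborel ?A"
    by (rule integrable_gaussian_bound[OF borel_measurable_continuous_onI[OF cA] zero_less_one])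
  have eq: "?B x = ?A x + ?\<kappa> * (\<Sum>b\<in>Basis. I b x)" for x
  proof -
    have "(\<Sum>b\<in>(Basis::'a set). (c * of_real (\<xi> \<bullet> b))\<^sup>2 - of_real (x \<bullet> b) * (c * of_real (\<xi> \<bullet> b)))
        = c\<^sup>2 * of_real ((norm \<xi>)\<^sup>2) - c * of_real (\<xi> \<bullet> x)"
      unfolding power2_norm_eq_inner euclidean_inner[of \<xi> \<xi>] euclidean_inner[of \<xi> x]
      by (simp add: sum_subtractf sum_distrib_left power2_eq_square mult_ac)
    then have OU: "hermite_exp_OU \<xi> c x = (\<Sum>b\<in>(Basis::'a set). (c * of_real (\<xi> \<bullet> b))\<^sup>2
        - of_real (x \<bullet> b) * (c * of_real (\<xi> \<bullet> b))) * ?H x"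
      by (simp only: hermite_exp_OU_def)
    have "(\<Sum>b\<in>(Basis::'a set). I b x) = complex_of_real (exp (- (norm x)\<^sup>2 / 2)) *
        (?H x * cnj (OU_expr \<eta> x) - hermite_exp_OU \<xi> c x * cnj (\<eta> x))"
      unfolding I_def OU_expr_def OU sum_distrib_left[symmetric] sum_subtractf complex_cnj_diff cnj_sum
      by (simp add: sum_distrib_left sum_distrib_right sum_subtractf right_diff_distrib left_diff_distrib
          mult_ac del: partials.simps)
    then show ?thesis
      by (simp only: gauss_weight_def) (simp add: scaleR_conv_of_real algebra_simps)
  qed
  have "(LINT x|lborel. ?B x) = (LINT x|lborel. ?A x) + ?\<kappa> * (\<Sum>b\<in>Basis. LINT x|lborel. I b x)"
    unfolding eq using iA green(1) by simp
  also have "(\<Sum>b\<in>(Basis::'a set). LINT x|lborel. I b x) = 0"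
    using green(2) by (intro sum.neutral) auto
  finally show "l2_inner gauss_measure (hermite_exp_OU \<xi> c) \<eta> = l2_inner gauss_measure ?H (OU_expr \<eta>)"
    unfolding l2_inner_def
    by (subst (1 2) integral_gauss_measure) (simp_all, measurable)
qed

text \<open>Rotating the parameter never leaves the family \<open>hermite_exp\<close>, so the
  candidate curve lies in the domain of the generator at all times and has to be the orbit.\<close>

lemma exp_itOU_hermite_exp:
  fixes \<xi> :: "'a::euclidean_space"
  assumes U: "is_exp_itA gauss_measure OU_operator U"
  shows "AE x in gauss_measure. U s (hermite_exp \<xi> c) x = hermite_exp \<xi> (c * exp (- \<i> * of_real s)) x"
proof -
  let ?v = "\<lambda>s::real. hermite_exp \<xi> (c * exp (- \<i> * of_real s))"
  have "AE x in gauss_measure. U s (?v 0) x = ?v s x"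
  proof (rule unitary_group_orbit[OF _ hermite_exp_L2 _ hermite_exp_rotation_L2_derivative])
    show "unitary_group gauss_measure U" using U by (simp add: is_exp_itA_def)
    show "generator gauss_measure U (?v s) (\<lambda>x. \<i> * hermite_exp_OU \<xi> (c * exp (- \<i> * of_real s)) x)" for s
      using U hermite_exp_OU_operator hermite_exp_L2 hermite_exp_OU_L2 unfolding is_exp_itA_def by blast
  qed
  then show ?thesis by simp
qed

section \<open>The Mehler formula\<close>

lemma integrable_inverse_1_plus_square_real: "integrable lborel (\<lambda>x::real. 1 / (1 + x\<^sup>2))"
  using integrable_inverse_1_plus_square by (simp add: set_integrable_def inverse_eq_divide)

text \<open>The majorant is a product of functions 1/(1 + r^2) of the coordinates. The m factors 1 +
  (x.b)^2 are at most 1 + |x|^2 each, which explains the decay of order 2m that is used. The square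
  is then bounded by a constant times the modulus.\<close>

lemma schwartz_integrable:
  fixes \<psi> :: "'a::euclidean_space \<Rightarrow> complex"
  assumes \<psi>: "\<psi> \<in> schwartz"
  shows "integrable lborel \<psi>" and "integrable lborel (\<lambda>x. (cmod (\<psi> x))\<^sup>2)"
proof -
  let ?m = "DIM('a)"
  have decay: "\<exists>C. \<forall>x. norm x ^ k * cmod (\<psi> x) \<le> C" for k
  proof -
    have "\<forall>k. \<forall>bs\<in>lists Basis. \<exists>C. \<forall>x. norm x ^ k * cmod (partials bs \<psi> x) \<le> C"
      using \<psi> by (simp add: schwartz_def)
    from this[rule_format, of "[]" k] show ?thesis by simp
  qed
  obtain C0 where C0: "\<And>x. cmod (\<psi> x) \<le> C0" using decay[of 0] by auto
  obtain C1 where C1: "\<And>x. norm x ^ (2 * ?m) * cmod (\<psi> x) \<le> C1" using decay[of "2 * ?m"] by auto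
  have [measurable]: "\<psi> \<in> borel_measurable borel"
    using smooth_imp_continuous_partials[of \<psi> "[]"] \<psi>
    by (intro borel_measurable_continuous_onI) (auto simp: schwartz_def)
  let ?g = "\<lambda>x::'a. \<Prod>b\<in>Basis. 1 / (1 + (x \<bullet> b)\<^sup>2)"
  have g: "integrable lborel ?g"
    by (rule integrable_lborel_prod_Basis[where f = "\<lambda>_ x. 1 / (1 + x\<^sup>2)"])
      (rule integrable_inverse_1_plus_square_real)
  have le: "cmod (\<psi> x) \<le> 2 ^ ?m * (C0 + C1) * ?g x" for x
  proof -
    have pos: "0 < (\<Prod>b\<in>Basis. 1 + (x \<bullet> b)\<^sup>2)" by (intro prod_pos) (simp add: add_pos_nonneg)
    have "(\<Prod>b\<in>Basis. 1 + (x \<bullet> b)\<^sup>2) \<le> (\<Prod>b\<in>(Basis::'a set). 1 + (norm x)\<^sup>2)"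
      using Basis_le_norm by (intro prod_mono) (auto simp: abs_le_square_iff[symmetric])
    also have "\<dots> = (1 + (norm x)\<^sup>2) ^ ?m" by simp
    also have "\<dots> \<le> (2 * max 1 ((norm x)\<^sup>2)) ^ ?m" by (intro power_mono) auto
    also have "\<dots> = 2 ^ ?m * max 1 ((norm x)\<^sup>2) ^ ?m" by (simp add: power_mult_distrib)
    also have "\<dots> \<le> 2 ^ ?m * (1 + norm x ^ (2 * ?m))"
      by (intro mult_left_mono) (auto simp: max_def power_mult)
    finally have "(\<Prod>b\<in>Basis. 1 + (x \<bullet> b)\<^sup>2) * cmod (\<psi> x) \<le> 2 ^ ?m * (1 + norm x ^ (2 * ?m)) * cmod (\<psi> x)"
      by (rule mult_right_mono) simp
    also have "\<dots> = 2 ^ ?m * (cmod (\<psi> x) + norm x ^ (2 * ?m) * cmod (\<psi> x))"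
      by (simp only: distrib_left distrib_right mult.assoc mult_1)
    also have "\<dots> \<le> 2 ^ ?m * (C0 + C1)" by (intro mult_left_mono add_mono C0 C1) simp
    finally show ?thesis using pos by (simp add: prod_dividef field_simps)
  qed
  show i: "integrable lborel \<psi>"
  proof (rule Bochner_Integration.integrable_bound)
    show "integrable lborel (\<lambda>x. 2 ^ ?m * (C0 + C1) * ?g x)" using g by (rule integrable_mult_right)
    show "AE x in lborel. norm (\<psi> x) \<le> norm (2 ^ ?m * (C0 + C1) * ?g x)"
      unfolding real_norm_def by (intro AE_I2 order_trans[OF le abs_ge_self])
  qed simp
  show "integrable lborel (\<lambda>x. (cmod (\<psi> x))\<^sup>2)"
  proof (rule Bochner_Integration.integrable_bound)
    show "integrable lborel (\<lambda>x. C0 * cmod (\<psi> x))" using i by simp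
    show "AE x in lborel. norm ((cmod (\<psi> x))\<^sup>2) \<le> norm (C0 * cmod (\<psi> x))"
    proof (rule AE_I2)
      fix x
      have "(cmod (\<psi> x))\<^sup>2 \<le> C0 * cmod (\<psi> x)"
        using C0[of x] by (simp add: power2_eq_square mult_right_mono)
      then show "norm ((cmod (\<psi> x))\<^sup>2) \<le> norm (C0 * cmod (\<psi> x))"
        using abs_ge_self[of "C0 * cmod (\<psi> x)"] by simp
    qed
  qed simp
qed

text \<open>The Gaussian density is a constant times the square of e^(-|x|^2/4), so the norm of
  \<phi> in L2(\<gamma>) is a multiple of the Lebesgue L2 norm of \<psi>.\<close>

lemma K_space_L2:
  fixes \<phi> :: "'a::euclidean_space \<Rightarrow> complex"
  assumes "\<phi> \<in> K_space"
  shows "\<phi> \<in> L2 gauss_measure"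
proof -
  have sm: "smooth \<phi>" and \<psi>: "(\<lambda>x. complex_of_real (exp (- (norm x)\<^sup>2 / 4)) * \<phi> x) \<in> schwartz"
    using assms by (auto simp: K_space_def)
  have [measurable]: "\<phi> \<in> borel_measurable borel"
    using smooth_imp_continuous_partials[OF sm, of "[]"] by (intro borel_measurable_continuous_onI) simp
  have "gauss_weight x *\<^sub>R (cmod (\<phi> x))\<^sup>2 = (2 * pi) powr (- real DIM('a) / 2) *
      (cmod (complex_of_real (exp (- (norm x)\<^sup>2 / 4)) * \<phi> x))\<^sup>2" for x
    by (simp add: gauss_weight_def norm_mult power_mult_distrib flip: exp_double)
  then have "integrable gauss_measure (\<lambda>x. (cmod (\<phi> x))\<^sup>2)"
    using schwartz_integrable(2)[OF \<psi>] by (subst integrable_gauss_measure) simp_all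
  then show ?thesis by (simp add: L2_def)
qed

section \<open>The kernel of the formula: constant, exponent and Fourier transform\<close>

definition mehler_const :: "nat \<Rightarrow> real \<Rightarrow> complex" where
  "mehler_const m t = complex_of_real ((4 * pi) powr (- real m / 2))
    * (exp (\<i> * of_nat m * complex_of_real t / 2)
      / (exp (\<i> * complex_of_real pi * of_nat m / 4) * complex_of_real (sin t powr (real m / 2))))"

text \<open>Since 1 - i cot t = -i e^(it) / sin t, a square root of (1 - i cot t)/4 is e^(i (t/2 -
  pi/4)) / (2 sqrt (sin t)). For 0 < t < pi its argument lies in (-pi/4, pi/4), so it is the
  principal one. The constant of the formula is thus the reciprocal of the factor produced by the
  Gaussian integral in m dimensions.\<close>

lemma mehler_const_cancel:
  assumes t: "0 < t" "t < pi"
  shows "mehler_const m t * (of_real (sqrt pi) / csqrt ((1 - \<i> * of_real (cot t)) / 4)) ^ m = 1"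
proof -
  have s: "0 < sin t" using t by (rule sin_gt_zero)
  define r where "r = complex_of_real (sqrt (sin t))"
  define p where "p = complex_of_real (sqrt pi)"
  have r: "r \<noteq> 0" "r * r = of_real (sin t)" using s by (auto simp: r_def simp flip: of_real_mult)
  have p: "p \<noteq> 0" by (simp add: p_def)
  define e where "e = exp (\<i> * complex_of_real t / 2) / exp (\<i> * complex_of_real pi / 4)"
  have e0: "e \<noteq> 0" by (simp add: e_def)
  have e_cis: "e = cis (t / 2 - pi / 4)"
    by (simp add: e_def cis_conv_exp exp_diff[symmetric] algebra_simps)
  have root: "csqrt ((1 - \<i> * of_real (cot t)) / 4) = e / (2 * r)"
  proof (rule csqrt_unique)
    have "e\<^sup>2 = cis (t - pi / 2)" by (simp add: e_cis power2_eq_square cis_mult)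
    also have "\<dots> = of_real (sin t) - \<i> * of_real (cos t)"
      by (simp add: complex_eq_iff cos_diff sin_diff)
    finally have "(e / (2 * r))\<^sup>2 = (of_real (sin t) - \<i> * of_real (cos t)) / (4 * of_real (sin t))"
      using r(2) by (simp add: power2_eq_square)
    also have "\<dots> = (1 - \<i> * of_real (cot t)) / 4"
      using s by (simp add: cot_def field_simps)
    finally show "(e / (2 * r))\<^sup>2 = (1 - \<i> * of_real (cot t)) / 4" .
    have "e / (2 * r) = of_real (1 / (2 * sqrt (sin t))) * cis (t / 2 - pi / 4)"
      by (simp add: e_cis r_def)
    then have "Re (e / (2 * r)) = cos (t / 2 - pi / 4) / (2 * sqrt (sin t))" by simp
    moreover have "0 < cos (t / 2 - pi / 4)" by (rule cos_gt_zero_pi) (use t in auto)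
    ultimately show "0 < Re (e / (2 * r)) \<or> Re (e / (2 * r)) = 0 \<and> 0 \<le> Im (e / (2 * r))"
      using s by simp
  qed
  have "(4 * pi) powr (- real m / 2) = (1 / (2 * sqrt pi)) ^ m"
  proof -
    have "(4 * pi) powr (- real m / 2) = ((4 * pi) powr (1 / 2)) powr (- real m)" by (simp add: powr_powr)
    also have "\<dots> = inverse (sqrt (4 * pi) ^ m)" by (simp add: powr_half_sqrt powr_minus powr_realpow)
    also have "\<dots> = (1 / (2 * sqrt pi)) ^ m" by (simp add: real_sqrt_mult power_one_over inverse_eq_divide)
    finally show ?thesis .
  qed
  then have 1: "complex_of_real ((4 * pi) powr (- real m / 2)) = (1 / (2 * p)) ^ m"
    by (simp add: p_def)
  have "sin t powr (real m / 2) = (sin t powr (1 / 2)) powr real m" by (simp add: powr_powr)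
  then have 2: "complex_of_real (sin t powr (real m / 2)) = r ^ m"
    using s by (simp add: powr_half_sqrt powr_realpow r_def)
  have 3: "exp (\<i> * of_nat m * complex_of_real t / 2) = exp (\<i> * complex_of_real t / 2) ^ m"
      "exp (\<i> * complex_of_real pi * of_nat m / 4) = exp (\<i> * complex_of_real pi / 4) ^ m"
    by (simp_all add: exp_of_nat_mult[symmetric] mult_ac)
  have "mehler_const m t * (of_real (sqrt pi) / csqrt ((1 - \<i> * of_real (cot t)) / 4)) ^ m
      = (1 / (2 * p) * (e / r) * (p / (e / (2 * r)))) ^ m"
    unfolding mehler_const_def 1 2 3 root p_def[symmetric] e_def
    by (simp add: power_mult_distrib power_divide)
  also have "1 / (2 * p) * (e / r) * (p / (e / (2 * r))) = 1" using r(1) p e0 by simp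
  finally show ?thesis by simp
qed

definition mehler_transform :: "real \<Rightarrow> ('a::euclidean_space \<Rightarrow> complex) \<Rightarrow> 'a \<Rightarrow> complex" where
  "mehler_transform t \<psi> x = mehler_const DIM('a) t
    * exp (\<i> * complex_of_real (cot t * (norm x)\<^sup>2 / 4))
    * fourier (\<lambda>y. exp (\<i> * complex_of_real (cot t * (norm y)\<^sup>2 / 4)) * \<psi> y) (x /\<^sub>R (4 * pi * sin t))"

text \<open>With s = sin t and k = cos t, the identity s^2 + k^2 = 1 gives 1/(1 - i k/s) = s (s + i
  k). The phases in |y|^2 then cancel and leave -|y|^2/4, while the remaining terms form the
  exponent of \<open>hermite_exp\<close> with parameter -i e^(-it).\<close>

lemma mehler_exponent:
  fixes \<xi> y :: "'a::euclidean_space"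
  assumes t: "0 < t" "t < pi"
  shows "\<i> * complex_of_real (cot t * (norm y)\<^sup>2 / 4)
      + (- \<i>)\<^sup>2 * of_real ((norm (\<xi> + y /\<^sub>R (2 * sin t)))\<^sup>2) / (4 * ((1 - \<i> * of_real (cot t)) / 4))
    = - of_real ((norm \<xi>)\<^sup>2) / 2 - of_real ((norm y)\<^sup>2) / 4
      + (- \<i> * exp (- \<i> * of_real t)) * of_real (\<xi> \<bullet> y)
      - (- \<i> * exp (- \<i> * of_real t))\<^sup>2 * of_real ((norm \<xi>)\<^sup>2) / 2"
proof -
  define s where "s = complex_of_real (sin t)"
  define k where "k = complex_of_real (cos t)"
  have s: "s \<noteq> 0" using sin_gt_zero[OF t] by (simp add: s_def)
  have sk: "s * s + k * k = 1"
    by (simp add: s_def k_def flip: of_real_mult of_real_add) (simp flip: power2_eq_square)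
  have E: "exp (- \<i> * of_real t) = k - \<i> * s"
    using cis_conv_exp[of "- t"] by (simp add: s_def k_def complex_eq_iff)
  have cot: "complex_of_real (cot t) = k / s" by (simp add: cot_def s_def k_def)
  have "(s - \<i> * k) * (s + \<i> * k) = 1" using sk by (simp add: algebra_simps)
  then have "1 / (s - \<i> * k) = s + \<i> * k"
    by (metis divide_inverse inverse_unique mult_1)
  moreover have "1 / (1 - \<i> * (k / s)) = s * (1 / (s - \<i> * k))"
    using s by (simp add: divide_simps)
  ultimately have inv: "1 / (1 - \<i> * (k / s)) = s * (s + \<i> * k)" by simp
  have n: "complex_of_real ((norm (\<xi> + y /\<^sub>R (2 * sin t)))\<^sup>2)
      = of_real ((norm \<xi>)\<^sup>2) + of_real (\<xi> \<bullet> y) / s + of_real ((norm y)\<^sup>2) / (4 * s * s)"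
  proof -
    have "(norm (\<xi> + y /\<^sub>R (2 * sin t)))\<^sup>2 = (norm \<xi>)\<^sup>2 + (\<xi> \<bullet> y) / sin t + (norm y)\<^sup>2 / (4 * sin t * sin t)"
      using sin_gt_zero[OF t] unfolding power2_norm_eq_inner
      by (simp add: inner_add_left inner_add_right inner_commute[of y \<xi>] field_simps)
    then show ?thesis by (simp add: s_def)
  qed
  define X where "X = complex_of_real ((norm \<xi>)\<^sup>2)"
  define Y where "Y = complex_of_real ((norm y)\<^sup>2)"
  define Z where "Z = complex_of_real (\<xi> \<bullet> y)"
  have c4: "4 * ((1 - \<i> * of_real (cot t)) / 4) = 1 - \<i> * (k / s)" by (simp add: cot)
  have "\<i> * complex_of_real (cot t * (norm y)\<^sup>2 / 4)
      + (- \<i>)\<^sup>2 * of_real ((norm (\<xi> + y /\<^sub>R (2 * sin t)))\<^sup>2) / (4 * ((1 - \<i> * of_real (cot t)) / 4))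
      = \<i> * (k / s) * Y / 4 - of_real ((norm (\<xi> + y /\<^sub>R (2 * sin t)))\<^sup>2) * (1 / (1 - \<i> * (k / s)))"
    unfolding c4 by (simp add: cot Y_def)
  also have "\<dots> = \<i> * (k / s) * Y / 4 - (X + Z / s + Y / (4 * s * s)) * (1 / (1 - \<i> * (k / s)))"
    by (simp only: n X_def Y_def Z_def)
  also have "\<dots> = \<i> * (k / s) * Y / 4 - (X + Z / s + Y / (4 * s * s)) * (s * (s + \<i> * k))"
    by (simp only: inv)
  also have "\<dots> = - X * (s * (s + \<i> * k)) - Y / 4 - Z * (s + \<i> * k)"
    using s by (simp add: field_simps)
  \<comment> \<open>In exponential form this is i sin t e^(-it) = (1 - e^(-2it))/2.\<close>
  also have "s * (s + \<i> * k) = 1 / 2 + (- \<i> * (k - \<i> * s))\<^sup>2 / 2"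
  proof -
    have "(- \<i> * (k - \<i> * s))\<^sup>2 = s * s - k * k + 2 * \<i> * s * k"
      by (simp add: power2_eq_square algebra_simps)
    also have "k * k = 1 - s * s" using sk by (simp add: algebra_simps)
    finally have sq: "(- \<i> * (k - \<i> * s))\<^sup>2 = s * s - (1 - s * s) + 2 * \<i> * s * k" .
    show ?thesis unfolding sq by (simp add: field_simps)
  qed
  finally show ?thesis
    unfolding E X_def[symmetric] Y_def[symmetric] Z_def[symmetric] by (simp add: algebra_simps)
qed

text \<open>The factor 2 pi in \<open>fourier\<close> and the scale 1/(4 pi sin t) combine to 1/(2
  sin t), placed on y because x becomes the inner integration variable.\<close>

lemma mehler_transform_eq:
  fixes \<psi> :: "'a::euclidean_space \<Rightarrow> complex"
  shows "mehler_transform t \<psi> x = mehler_const DIM('a) t * exp (\<i> * complex_of_real (cot t * (norm x)\<^sup>2 / 4))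
    * (LINT y|lborel. exp (- \<i> * of_real (x \<bullet> (y /\<^sub>R (2 * sin t))))
      * (exp (\<i> * complex_of_real (cot t * (norm y)\<^sup>2 / 4)) * \<psi> y))"
proof -
  have "- 2 * complex_of_real pi * \<i> * complex_of_real ((x /\<^sub>R (4 * pi * sin t)) \<bullet> y)
      = - \<i> * of_real (x \<bullet> (y /\<^sub>R (2 * sin t)))" for y
    by (simp add: divide_simps)
  then show ?thesis unfolding mehler_transform_def fourier_def by (simp only:)
qed

lemma
  fixes \<psi> :: "'a::euclidean_space \<Rightarrow> complex"
  assumes \<psi>: "integrable lborel \<psi>"
  shows mehler_transform_measurable: "mehler_transform t \<psi> \<in> borel_measurable borel"
    and mehler_transform_bounded: "\<exists>C. \<forall>x. cmod (mehler_transform t \<psi> x) \<le> C"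
proof -
  have [measurable]: "\<psi> \<in> borel_measurable borel" using \<psi> by auto
  show "mehler_transform t \<psi> \<in> borel_measurable borel"
    unfolding mehler_transform_eq[abs_def] by measurable
  have "cmod (mehler_transform t \<psi> x) \<le> cmod (mehler_const DIM('a) t) * (LINT y|lborel. cmod (\<psi> y))" for x
  proof -
    have "cmod (LINT y|lborel. exp (- \<i> * of_real (x \<bullet> (y /\<^sub>R (2 * sin t))))
        * (exp (\<i> * complex_of_real (cot t * (norm y)\<^sup>2 / 4)) * \<psi> y))
      \<le> (LINT y|lborel. cmod (exp (- \<i> * of_real (x \<bullet> (y /\<^sub>R (2 * sin t))))
        * (exp (\<i> * complex_of_real (cot t * (norm y)\<^sup>2 / 4)) * \<psi> y)))"
      by (rule integral_norm_bound)
    then show ?thesis unfolding mehler_transform_eq by (simp add: norm_mult mult_left_mono)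
  qed
  then show "\<exists>C. \<forall>x. cmod (mehler_transform t \<psi> x) \<le> C" by blast
qed

text \<open>The modulus of the double integrand is a constant times e^(-|x|^2/4) |\<psi>(y)|, so x
  may be integrated first. That integral is Gaussian with parameter (1 - i cot t)/4, the 1/4 coming
  from the weight and the rest from the phase in x. Its prefactor cancels the constant by
  \<open>mehler_const_cancel\<close>, and \<open>mehler_exponent\<close> identifies its
  exponent.\<close>

lemma integral_mehler_transform:
  fixes \<psi> :: "'a::euclidean_space \<Rightarrow> complex"
  assumes \<psi>: "integrable lborel \<psi>" and t: "0 < t" "t < pi"
  shows "(LINT x|lborel. of_real (exp (- (norm x)\<^sup>2 / 4)) * mehler_transform t \<psi> x * exp (- \<i> * of_real (\<xi> \<bullet> x)))
    = exp (- of_real ((norm \<xi>)\<^sup>2) / 2)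
      * (LINT y|lborel. of_real (exp (- (norm y)\<^sup>2 / 4)) * \<psi> y * hermite_exp \<xi> (- \<i> * exp (- \<i> * of_real t)) y)"
proof -
  have [measurable]: "\<psi> \<in> borel_measurable borel" using \<psi> by auto
  define A where "A = mehler_const DIM('a) t"
  define \<alpha> where "\<alpha> = (1 - \<i> * complex_of_real (cot t)) / 4"
  have \<alpha>: "0 < Re \<alpha>" by (simp add: \<alpha>_def)
  define q where "q = (\<lambda>y. exp (\<i> * complex_of_real (cot t * (norm y)\<^sup>2 / 4)) * \<psi> y)"
  let ?e = "\<lambda>x y. exp (- \<alpha> * of_real ((norm x)\<^sup>2) + (- \<i>) * of_real ((\<xi> + y /\<^sub>R (2 * sin t)) \<bullet> x))"
  have "(LINT x|lborel. LINT y|lborel. A * q y * ?e x y) = (LINT y|lborel. LINT x|lborel. A * q y * ?e x y)"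
  proof (rule Fubini_dominated[symmetric])
    show "integrable lborel (\<lambda>x::'a. exp (- (1 / 4) * (norm x)\<^sup>2))"
      by (rule integrable_gaussian_euclidean) simp
    show "integrable lborel (\<lambda>y. cmod A * cmod (\<psi> y))" using \<psi> by simp
    show "cmod (A * q y * ?e x y) \<le> exp (- (1 / 4) * (norm x)\<^sup>2) * (cmod A * cmod (\<psi> y))" for x y
      by (simp add: q_def norm_mult \<alpha>_def)
    show "(\<lambda>(x, y). A * q y * ?e x y) \<in> borel_measurable (lborel \<Otimes>\<^sub>M lborel)"
      unfolding q_def by measurable
  qed
  moreover have "(LINT y|lborel. A * q y * ?e x y)
      = of_real (exp (- (norm x)\<^sup>2 / 4)) * mehler_transform t \<psi> x * exp (- \<i> * of_real (\<xi> \<bullet> x))" for x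
  proof -
    have "?e x y = of_real (exp (- (norm x)\<^sup>2 / 4)) * exp (\<i> * complex_of_real (cot t * (norm x)\<^sup>2 / 4))
        * exp (- \<i> * of_real (\<xi> \<bullet> x)) * exp (- \<i> * of_real (x \<bullet> (y /\<^sub>R (2 * sin t))))" for y
      unfolding exp_of_real[symmetric] exp_add[symmetric]
      by (simp add: \<alpha>_def inner_add_left inner_commute[of y x] field_simps)
    then have "(LINT y|lborel. A * q y * ?e x y)
        = (LINT y|lborel. (A * of_real (exp (- (norm x)\<^sup>2 / 4)) * exp (\<i> * complex_of_real (cot t * (norm x)\<^sup>2 / 4))
          * exp (- \<i> * of_real (\<xi> \<bullet> x))) * (exp (- \<i> * of_real (x \<bullet> (y /\<^sub>R (2 * sin t)))) * q y))"
      by (simp only: mult_ac)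
    then show ?thesis
      unfolding integral_mult_right_zero mehler_transform_eq A_def q_def by (simp only: mult_ac)
  qed
  moreover have "(LINT x|lborel. A * q y * ?e x y) = exp (- of_real ((norm \<xi>)\<^sup>2) / 2)
      * (of_real (exp (- (norm y)\<^sup>2 / 4)) * \<psi> y * hermite_exp \<xi> (- \<i> * exp (- \<i> * of_real t)) y)" for y
  proof -
    have "(LINT x|lborel. A * q y * ?e x y)
        = (A * (of_real (sqrt pi) / csqrt \<alpha>) ^ DIM('a))
          * (q y * exp ((- \<i>)\<^sup>2 * of_real ((norm (\<xi> + y /\<^sub>R (2 * sin t)))\<^sup>2) / (4 * \<alpha>)))"
      unfolding integral_mult_right_zero integral_gaussian_linear[OF \<alpha>] by (simp only: mult_ac)
    also have "A * (of_real (sqrt pi) / csqrt \<alpha>) ^ DIM('a) = 1"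
      unfolding A_def \<alpha>_def by (rule mehler_const_cancel[OF t])
    also have "1 * (q y * exp ((- \<i>)\<^sup>2 * of_real ((norm (\<xi> + y /\<^sub>R (2 * sin t)))\<^sup>2) / (4 * \<alpha>)))
        = \<psi> y * exp (\<i> * complex_of_real (cot t * (norm y)\<^sup>2 / 4)
          + (- \<i>)\<^sup>2 * of_real ((norm (\<xi> + y /\<^sub>R (2 * sin t)))\<^sup>2) / (4 * \<alpha>))"
      unfolding q_def exp_add by (simp only: mult_ac mult_1_left)
    also have "\<dots> = \<psi> y * exp (- of_real ((norm \<xi>)\<^sup>2) / 2 + of_real (- (norm y)\<^sup>2 / 4)
        + ((- \<i> * exp (- \<i> * of_real t)) * of_real (\<xi> \<bullet> y)
        - (- \<i> * exp (- \<i> * of_real t))\<^sup>2 * of_real ((norm \<xi>)\<^sup>2) / 2))"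
      unfolding \<alpha>_def mehler_exponent[OF t] by (simp add: algebra_simps)
    also have "\<dots> = exp (- of_real ((norm \<xi>)\<^sup>2) / 2)
        * (of_real (exp (- (norm y)\<^sup>2 / 4)) * \<psi> y * hermite_exp \<xi> (- \<i> * exp (- \<i> * of_real t)) y)"
      unfolding hermite_exp_def exp_add exp_of_real by (simp only: mult_ac)
    finally show ?thesis .
  qed
  ultimately show ?thesis by simp
qed

section \<open>Comparison of the two Fourier transforms\<close>

lemma hermite_exp_cnj: "cnj (hermite_exp \<xi> c x) = hermite_exp \<xi> (cnj c) x"
  by (simp add: hermite_exp_def exp_cnj)

text \<open>The function with parameter c is the image at time t of the one with parameter c e^(it),
  so unitarity removes U t from both arguments.\<close>

lemma l2_inner_exp_itOU_hermite_exp: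
  fixes \<xi> :: "'a::euclidean_space"
  assumes U: "is_exp_itA gauss_measure OU_operator U" and \<phi>: "\<phi> \<in> L2 gauss_measure"
  shows "l2_inner gauss_measure (U t \<phi>) (hermite_exp \<xi> c)
    = l2_inner gauss_measure \<phi> (hermite_exp \<xi> (c * exp (\<i> * of_real t)))"
proof -
  have G: "unitary_group gauss_measure U" using U by (simp add: is_exp_itA_def)
  let ?H = "hermite_exp \<xi> (c * exp (\<i> * of_real t))"
  note [measurable] = L2_measurable[OF unitary_group_mem[OF G \<phi>], simplified]
    L2_measurable[OF unitary_group_mem[OF G hermite_exp_L2[of \<xi> "c * exp (\<i> * of_real t)"]], simplified]
  have "AE x in gauss_measure. U t ?H x = hermite_exp \<xi> c x"
    using exp_itOU_hermite_exp[OF U, of t \<xi> "c * exp (\<i> * of_real t)"]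
    by (simp add: mult.assoc flip: exp_add)
  then have "l2_inner gauss_measure (U t \<phi>) (hermite_exp \<xi> c) = l2_inner gauss_measure (U t \<phi>) (U t ?H)"
    unfolding l2_inner_def by (intro integral_cong_AE) auto
  also have "\<dots> = l2_inner gauss_measure \<phi> ?H"
    by (rule unitary_group_inner[OF G \<phi> hermite_exp_L2])
  finally show ?thesis .
qed

lemma L2_integrable_weighted:
  fixes f :: "'a::euclidean_space \<Rightarrow> complex"
  assumes f: "f \<in> L2 gauss_measure"
  shows "integrable lborel (\<lambda>x. of_real (gauss_weight x) * f x)"
proof -
  have [measurable]: "f \<in> borel_measurable borel" using L2_measurable[OF f] by simp
  have "integrable gauss_measure f"
  proof (rule Bochner_Integration.integrable_bound)
    show "integrable gauss_measure (\<lambda>x. 1 + (cmod (f x))\<^sup>2)"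
      \<comment> \<open>Growth rate 0 yields integrability of the constant 1.\<close>
      using integrable_gauss_measure_exp_growth[where 'a = 'a, of 0] L2_integrable[OF f] by simp
    show "AE x in gauss_measure. cmod (f x) \<le> norm (1 + (cmod (f x))\<^sup>2)"
      using abs_le_one_plus_square[of "cmod (f x)" for x] by (intro AE_I2) (simp add: abs_of_nonneg)
  qed simp
  then show ?thesis
    by (subst (asm) integrable_gauss_measure) (simp_all add: scaleR_conv_of_real)
qed

lemma exp_itOU_mehler:
  fixes \<phi> \<psi> :: "'a::euclidean_space \<Rightarrow> complex"
  assumes U: "is_exp_itA gauss_measure OU_operator U"
    and \<phi>: "\<phi> \<in> L2 gauss_measure"
    and \<psi>_def: "\<psi> = (\<lambda>x. complex_of_real (exp (- (norm x)\<^sup>2 / 4)) * \<phi> x)"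
    and \<psi>: "integrable lborel \<psi>"
    and t: "0 < t" "t < pi"
  shows "AE x in lborel. complex_of_real (exp (- (norm x)\<^sup>2 / 4)) * U t \<phi> x = mehler_transform t \<psi> x"
proof -
  have G: "unitary_group gauss_measure U" using U by (simp add: is_exp_itA_def)
  note UL = unitary_group_mem[OF G \<phi>, of t]
  note [measurable] = mehler_transform_measurable[OF \<psi>] L2_measurable[OF UL, simplified]
    L2_measurable[OF \<phi>, simplified]
  define \<kappa> where "\<kappa> = complex_of_real ((2 * pi) powr (- real DIM('a) / 2))"
  have \<kappa>: "\<kappa> \<noteq> 0" by (simp add: \<kappa>_def)
  define w where "w = (\<lambda>x::'a. complex_of_real (exp (- (norm x)\<^sup>2 / 4)))"
  have \<psi>w: "\<psi> x = w x * \<phi> x" for x by (simp add: \<psi>_def w_def)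
  have w: "w x \<noteq> 0" "complex_of_real (gauss_weight x) = \<kappa> * (w x * w x)" for x
    by (simp_all add: w_def \<kappa>_def gauss_weight_def exp_of_real[symmetric] exp_add[symmetric])
  \<comment> \<open>\<open>k1\<close> and \<open>k2\<close> are the two sides of the claim times
    \<kappa> e^(-|x|^2/4). This makes both integrable, and the factor never vanishes, so it can be
    divided out.\<close>
  define k1 where "k1 = (\<lambda>x. of_real (gauss_weight x) * U t \<phi> x)"
  define k2 where "k2 = (\<lambda>x. \<kappa> * (w x * mehler_transform t \<psi> x))"
  have i1: "integrable lborel k1" unfolding k1_def by (rule L2_integrable_weighted[OF UL])
  obtain C where C: "\<And>x. cmod (mehler_transform t \<psi> x) \<le> C"
    using mehler_transform_bounded[OF \<psi>] by blast
  have i2: "integrable lborel k2"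
  proof (rule integrable_gaussian_bound)
    show "cmod (k2 x) \<le> (cmod \<kappa> * C) * exp (- (1 / 4) * (norm x)\<^sup>2)" for x
    proof -
      have "cmod \<kappa> * (exp (- (norm x)\<^sup>2 / 4) * cmod (mehler_transform t \<psi> x))
          \<le> cmod \<kappa> * (exp (- (norm x)\<^sup>2 / 4) * C)"
        by (intro mult_left_mono C) auto
      then show ?thesis by (simp add: k2_def w_def norm_mult mult_ac)
    qed
    show "k2 \<in> borel_measurable borel" unfolding k2_def w_def by measurable
  qed simp
  have "(LINT x|lborel. (k1 x - k2 x) * exp (- \<i> * of_real (\<xi> \<bullet> x))) = 0" for \<xi>
  proof -
    let ?q = "exp (- complex_of_real ((norm \<xi>)\<^sup>2) / 2)"
    let ?H = "hermite_exp \<xi> (- \<i> * exp (- \<i> * of_real t))"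
    have e: "exp (- \<i> * of_real (\<xi> \<bullet> x)) = ?q * cnj (hermite_exp \<xi> \<i> x)" for x
      by (simp add: hermite_exp_cnj) (simp add: hermite_exp_def flip: exp_add)
    have bd: "integrable lborel (\<lambda>x. k x * exp (- \<i> * of_real (\<xi> \<bullet> x)))"
      if k: "integrable lborel k" for k :: "'a \<Rightarrow> complex"
      by (rule Bochner_Integration.integrable_bound[OF k]) (use k in \<open>auto simp: norm_mult\<close>)
    have "(LINT x|lborel. k1 x * exp (- \<i> * of_real (\<xi> \<bullet> x)))
        = (LINT x|lborel. ?q * (gauss_weight x *\<^sub>R (U t \<phi> x * cnj (hermite_exp \<xi> \<i> x))))"
      unfolding e k1_def scaleR_conv_of_real by (simp only: mult_ac)
    also have "\<dots> = ?q * l2_inner gauss_measure (U t \<phi>) (hermite_exp \<xi> \<i>)"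
      unfolding integral_mult_right_zero l2_inner_def by (subst integral_gauss_measure) simp_all
    also have "\<dots> = ?q * l2_inner gauss_measure \<phi> (hermite_exp \<xi> (\<i> * exp (\<i> * of_real t)))"
      by (simp only: l2_inner_exp_itOU_hermite_exp[OF U \<phi>])
    \<comment> \<open>The inner product conjugates its second argument, which turns the parameter i
      e^(it) into -i e^(-it).\<close>
    also have "\<dots> = ?q * (LINT x|lborel. gauss_weight x *\<^sub>R (\<phi> x * ?H x))"
      unfolding l2_inner_def hermite_exp_cnj by (subst integral_gauss_measure) (simp_all add: exp_cnj)
    also have "\<dots> = ?q * (LINT x|lborel. \<kappa> * (w x * \<psi> x * ?H x))"
      unfolding \<psi>w scaleR_conv_of_real w(2) by (simp only: mult_ac)
    also have "\<dots> = \<kappa> * (?q * (LINT x|lborel. w x * \<psi> x * ?H x))"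
      unfolding integral_mult_right_zero by (simp only: mult_ac)
    also have "?q * (LINT x|lborel. w x * \<psi> x * ?H x)
        = (LINT x|lborel. w x * mehler_transform t \<psi> x * exp (- \<i> * of_real (\<xi> \<bullet> x)))"
      unfolding w_def by (rule integral_mehler_transform[OF \<psi> t, symmetric])
    also have "\<kappa> * \<dots> = (LINT x|lborel. k2 x * exp (- \<i> * of_real (\<xi> \<bullet> x)))"
      unfolding integral_mult_right_zero[symmetric] k2_def by (simp only: mult.assoc)
    finally show ?thesis
      using bd[OF i1] bd[OF i2] by (simp add: left_diff_distrib)
  qed
  then have "AE x in lborel. k1 x - k2 x = 0"
    by (intro AE_eq_0_if_fourier_eq_0 Bochner_Integration.integrable_diff i1 i2)
  then show ?thesis
  proof eventually_elim
    case (elim x)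
    then have "(\<kappa> * w x) * (w x * U t \<phi> x) = (\<kappa> * w x) * mehler_transform t \<psi> x"
      by (simp add: k1_def k2_def w(2) mult_ac)
    then show ?case using \<kappa> w(1)[of x] by (simp add: w_def)
  qed
qed

theorem proposition1p2:
  fixes \<phi> \<psi> :: "real ^ 'm \<Rightarrow> complex"
    and U :: "real \<Rightarrow> (real ^ 'm \<Rightarrow> complex) \<Rightarrow> (real ^ 'm \<Rightarrow> complex)"
    and t :: real
  assumes U: "is_exp_itA gauss_measure OU_operator U"
    and phi: "\<phi> \<in> K_space"
    and psi: "\<psi> = (\<lambda>x. complex_of_real (exp (- (norm x)\<^sup>2 / 4)) * \<phi> x)"
    and t: "0 < t" "t < pi"
  shows "AE x in gauss_measure.
    complex_of_real (exp (- (norm x)\<^sup>2 / 4)) * U t \<phi> x =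
      complex_of_real ((4 * pi) powr (- real CARD('m) / 2))
      * (exp (\<i> * of_nat CARD('m) * complex_of_real t / 2)
         / (exp (\<i> * complex_of_real pi * of_nat CARD('m) / 4)
            * complex_of_real (sin t powr (real CARD('m) / 2))))
      * exp (\<i> * complex_of_real (cot t * (norm x)\<^sup>2 / 4))
      * fourier (\<lambda>y. exp (\<i> * complex_of_real (cot t * (norm y)\<^sup>2 / 4)) * \<psi> y)
          (x /\<^sub>R (4 * pi * sin t))"
proof -
  have psi_int: "integrable lborel \<psi>"
    using phi unfolding psi K_space_def by (intro schwartz_integrable(1)) simp
  have "AE x in lborel. complex_of_real (exp (- (norm x)\<^sup>2 / 4)) * U t \<phi> x = mehler_transform t \<psi> x"
    by (rule exp_itOU_mehler[OF U K_space_L2[OF phi] psi psi_int t])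
  \<comment> \<open>The Gaussian density is positive everywhere, so both measures have the same null
    sets.\<close>
  then show ?thesis
    unfolding AE_gauss_measure mehler_transform_def mehler_const_def by simp
qed

end
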